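(* There exist integers $2\le n_1<n_2<n_3$ and two sets $\mathcal{D},\mathcal{D}'\subset\prod_{q=1}^3\{0,\dots,n_q-1\}$, each with at least two elements, such that the Bedford--McMullen sponges $F,F'\subset[0,1]^3$ generated by $\mathcal{D}$ and $\mathcal{D}'$ on this common grid both have non-uniform fibres, are homeomorphic, and satisfy $$\dim_{\mathrm B}F=\dim_{\mathrm B}F',\qquad \dim_{\mathrm L}F=\dim_{\mathrm L}F',\qquad \dim_{\mathrm A}F=\dim_{\mathrm A}F',$$ but their Assouad spectra $\theta\mapsto\dim_{\mathrm A}^{\theta}F$ and $\theta\mapsto\dim_{\mathrm A}^{\theta}F'$ are different functions on $(0,1)$, and their lower spectra $\theta\mapsto\dim_{\mathrm L}^{\theta}F$ and $\theta\mapsto\dim_{\mathrm L}^{\theta}F'$ are different functions on $(0,1)$; consequently $F$ and $F'$ are not bi-Lipschitz equivalent.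
   Context: **Dimensions.** For bounded $E\subset\mathbb{R}^d$ and $r>0$, $N(E,r)$ is the minimal number of balls of radius $r$ required to cover $E$; $B(x,R)$ is the closed ball with centre $x$ and radius $R$. Let $F\subset\mathbb{R}^d$ be non-empty and compact. - Box dimension: $\dim_{\mathrm B}F=\lim_{r\to0}\frac{\log N(F,r)}{\log(1/r)}$ when the limit exists (it does for Bedford--McMullen sponges). - Assouad dimension: $\dim_{\mathrm A}F$ is the infimum of all $s>0$ for which there is $C>0$ such that $N(B(x,R)\cap F,r)\le C(R/r)^s$ for all $x\in F$ and $0<r<R$. - Lower dimension: $\dim_{\mathrm L}F$ is the supremum of all $s>0$ for which there is $C>0$ such that $N(B(x,R)\cap F,r)\ge C(R/r)^s$ for all $x\in F$ and $0<r<R<1$. - For $\theta\in(0,1)$, the Assouad spectrum $\dim_{\mathrm A}^{\theta}F$ is the infimum of all $s>0$ for which there is $C>0$ such that $N(B(x,R)\cap F,R^{1/\theta})\le C(R/R^{1/\theta})^s$ for all $0<R<1$ and $x\in F$. - For $\theta\in(0,1)$, the lower spectrum $\dim_{\mathrm L}^{\theta}F$ is the supremum of all $s>0$ for which there is $C>0$ such that $N(B(x,R)\cap F,R^{1/\theta})\ge C(R/R^{1/\theta})^s$ for all $0<R<1$ and $x\in F$. The supremum of the empty set is taken to be $0$. **Bedford--McMullen sponges.** Let $2\le n_1<\dots<n_d$ be integers (the grid), $\mathcal{I}_q=\{0,\dots,n_q-1\}$, and let $\mathcal{D}\subset\prod_{q=1}^d\mathcal{I}_q$ have at least two elements. For $\bar\imath=(i_1,\dots,i_d)\in\mathcal{D}$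 let $\varphi_{\bar\imath}(x_1,\dots,x_d)=\left(\frac{x_1+i_1}{n_1},\dots,\frac{x_d+i_d}{n_d}\right)$ on $[0,1]^d$. Let $\mathcal{D}^\infty$ be the set of infinite words $\omega=(\bar\imath_1,\bar\imath_2,\dots)$ over $\mathcal{D}$ and $\Pi(\omega)$ the unique point of $\bigcap_{l\in\mathbb{N}}\varphi_{\bar\imath_1}\circ\cdots\circ\varphi_{\bar\imath_l}([0,1]^d)$. The Bedford--McMullen sponge generated by $\mathcal{D}$ is $F=\Pi(\mathcal{D}^\infty)$. For $1\le l\le d$, $\pi_l$ denotes projection of $\mathcal{D}$ onto the first $l$ coordinates, and for $1\le l\le d-1$ and $(i_1,\dots,i_l)\in\pi_l\mathcal{D}$, $$N(i_1,\dots,i_l)=|\{i_{l+1}\in\mathcal{I}_{l+1}:(i_1,\dots,i_l,i_{l+1})\in\pi_{l+1}\mathcal{D}\}|.$$ $F$ has uniform fibres if for every $l=1,\dots,d-1$ the number $N(i_1,\dots,i_l)$ is the same for all $(i_1,\dots,i_l)\in\pi_l\mathcal{D}$; otherwise it has non-uniform fibres. Two sets are bi-Lipschitz equivalent if there is a bi-Lipschitz bijection between them. *)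

theory Defs
  imports "HOL-Analysis.Analysis"
begin

section \<open>Dimensions\<close>

text \<open>Balls are closed, and their centres may be any points of the ambient space. For bounded
  \<open>E\<close> in a Euclidean space and \<open>r > 0\<close> a finite cover exists.\<close>

definition covering_number :: "'a::metric_space set \<Rightarrow> real \<Rightarrow> nat" where
  "covering_number E r = (LEAST k. \<exists>C. finite C \<and> card C = k \<and> E \<subseteq> (\<Union>c\<in>C. cball c r))"

definition has_box_dimension :: "'a::euclidean_space set \<Rightarrow> real \<Rightarrow> bool" where
  "has_box_dimension F s \<longleftrightarrow>
     ((\<lambda>r. ln (real (covering_number F r)) / ln (1 / r)) \<longlongrightarrow> s) (at_right 0)"

text \<open>Meaningful only if the limit exists; \<open>has_box_dimension F (box_dimension F)\<close> says that it does.\<close>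

definition box_dimension :: "'a::euclidean_space set \<Rightarrow> real" where
  "box_dimension F = (THE s. has_box_dimension F s)"

text \<open>For a non-empty compact subset of a Euclidean space, the sets of exponents whose infimum is
  taken are non-empty, and those whose supremum is taken are bounded above. Inserting \<open>0\<close> into
  the latter, which contain only positive numbers, makes the supremum of the empty set \<open>0\<close>.\<close>

definition assouad_dimension :: "'a::euclidean_space set \<Rightarrow> real" where
  "assouad_dimension F = Inf {s. s > 0 \<and>
     (\<exists>C>0. \<forall>x\<in>F. \<forall>r R. 0 < r \<and> r < R \<longrightarrow>
        real (covering_number (cball x R \<inter> F) r) \<le> C * (R / r) powr s)}"

definition lower_dimension :: "'a::euclidean_space set \<Rightarrow> real" where
  "lower_dimension F = Sup (insert 0 {s. s > 0 \<and>
     (\<exists>C>0. \<forall>x\<in>F. \<forall>r R. 0 < r \<and> r < R \<and> R < 1 \<longrightarrow>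
        real (covering_number (cball x R \<inter> F) r) \<ge> C * (R / r) powr s)})"

definition assouad_spectrum :: "'a::euclidean_space set \<Rightarrow> real \<Rightarrow> real" where
  "assouad_spectrum F \<theta> = Inf {s. s > 0 \<and>
     (\<exists>C>0. \<forall>R x. 0 < R \<and> R < 1 \<and> x \<in> F \<longrightarrow>
        real (covering_number (cball x R \<inter> F) (R powr (1 / \<theta>)))
          \<le> C * (R / R powr (1 / \<theta>)) powr s)}"

definition lower_spectrum :: "'a::euclidean_space set \<Rightarrow> real \<Rightarrow> real" where
  "lower_spectrum F \<theta> = Sup (insert 0 {s. s > 0 \<and>
     (\<exists>C>0. \<forall>R x. 0 < R \<and> R < 1 \<and> x \<in> F \<longrightarrow>
        real (covering_number (cball x R \<inter> F) (R powr (1 / \<theta>)))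
          \<ge> C * (R / R powr (1 / \<theta>)) powr s)})"

definition bi_lipschitz_equivalent :: "'a::metric_space set \<Rightarrow> 'b::metric_space set \<Rightarrow> bool" where
  "bi_lipschitz_equivalent E E' \<longleftrightarrow>
     (\<exists>f C. bij_betw f E E' \<and> C-lipschitz_on E f \<and> C-lipschitz_on E' (inv_into E f))"

section \<open>Bedford--McMullen sponges\<close>

text \<open>The coordinates are indexed by a finite linearly ordered type \<open>'d\<close>. A digit is a function
  \<open>i :: 'd \<Rightarrow> nat\<close>, and \<open>n q\<close> is the number of subdivisions in coordinate \<open>q\<close>. The grid is intended
  to be strictly increasing with \<open>2 \<le> n q\<close>. For the index type \<open>3\<close>, the coordinates in
  increasing order are \<open>0, 1, 2\<close> (and the numeral \<open>3\<close> denotes \<open>0\<close>):\<close>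

lemma order_3: "(0::3) < 1" "(1::3) < 2"
  by (simp_all add: less_bit1_def bit1.Rep_0 bit1.Rep_1 bit1.Rep_numeral)

definition digit_box :: "('d \<Rightarrow> nat) \<Rightarrow> ('d \<Rightarrow> nat) set" where
  "digit_box n = {i. \<forall>q. i q < n q}"

definition digit_map :: "('d::finite \<Rightarrow> nat) \<Rightarrow> ('d \<Rightarrow> nat) \<Rightarrow> real ^ 'd \<Rightarrow> real ^ 'd" where
  "digit_map n i x = (\<chi> q. (x $ q + real (i q)) / real (n q))"

fun word_map ::
  "('d::finite \<Rightarrow> nat) \<Rightarrow> (nat \<Rightarrow> 'd \<Rightarrow> nat) \<Rightarrow> nat \<Rightarrow> real ^ 'd \<Rightarrow> real ^ 'd" where
  "word_map n \<omega> 0 = id"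
| "word_map n \<omega> (Suc l) = word_map n \<omega> l \<circ> digit_map n (\<omega> l)"

text \<open>Infinite words are indexed from \<open>0\<close>, and \<open>cbox 0 1\<close> is the unit cube.\<close>

definition coding_map :: "('d::finite \<Rightarrow> nat) \<Rightarrow> (nat \<Rightarrow> 'd \<Rightarrow> nat) \<Rightarrow> real ^ 'd" where
  "coding_map n \<omega> = (THE x. x \<in> (\<Inter>l. word_map n \<omega> l ` cbox 0 1))"

definition sponge :: "('d::finite \<Rightarrow> nat) \<Rightarrow> ('d \<Rightarrow> nat) set \<Rightarrow> (real ^ 'd) set" where
  "sponge n D = coding_map n ` {\<omega>. \<forall>k. \<omega> k \<in> D}"

text \<open>Projections onto initial segments of coordinates are encoded by \<open>restrict\<close>. If \<open>q\<close> is the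
  \<open>(l+1)\<close>-st coordinate, then \<open>proj {..<q} D\<close> is \<open>\<pi>\<^sub>l D\<close>, \<open>proj {..q} D\<close> is the next projection,
  and \<open>u(q := j)\<close> appends the entry \<open>j\<close> to \<open>u\<close>. The condition \<open>p < q\<close> below excludes \<open>l = 0\<close>.\<close>

definition proj :: "'d set \<Rightarrow> ('d \<Rightarrow> nat) set \<Rightarrow> ('d \<Rightarrow> nat) set" where
  "proj Q D = (\<lambda>i. restrict i Q) ` D"

definition fibre_count ::
  "('d::linorder \<Rightarrow> nat) \<Rightarrow> ('d \<Rightarrow> nat) set \<Rightarrow> 'd \<Rightarrow> ('d \<Rightarrow> nat) \<Rightarrow> nat" where
  "fibre_count n D q u = card {j. j < n q \<and> u(q := j) \<in> proj {..q} D}"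

definition uniform_fibres :: "('d::linorder \<Rightarrow> nat) \<Rightarrow> ('d \<Rightarrow> nat) set \<Rightarrow> bool" where
  "uniform_fibres n D \<longleftrightarrow>
     (\<forall>q. (\<exists>p. p < q) \<longrightarrow>
        (\<forall>u\<in>proj {..<q} D. \<forall>v\<in>proj {..<q} D. fibre_count n D q u = fibre_count n D q v))"

end

theory Submission
  imports Defs
begin

text \<open>
  On the grid (4, 16, 256) use only the digits 0 and 2. In both sponges the first two coordinates are
  free, and the third coordinate may be 2 only where the first one (for \<open>D\<close>), respectively the second
  one (for \<open>D'\<close>), is 2. The digits 0 and 2 leave gaps, so balls and approximate cubes are
  interchangeable, and swapping the first two coordinates of the words is a homeomorphism.

  An approximate cube of side \<open>256\<^sup>-\<^sup>a\<close> fixes \<open>4a\<close>, \<open>2a\<close> and \<open>a\<close> letters of the three coordinates.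
  Inside it, going down to side \<open>256\<^sup>-\<^sup>b\<close>, every new letter of the first two coordinates contributes a
  factor 2. A new letter of the third contributes 1 or 2 if the letter that controls it is already
  fixed by the cube, and 3/2 on average if it is not. Let \<open>p\<close> be 4 for \<open>D\<close> and 2 for \<open>D'\<close>, so that the
  controlling coordinate is fixed up to position \<open>pa\<close>. For \<open>a = 0\<close> the count does not depend on \<open>p\<close>, and
  for \<open>b = 2a\<close> the extreme factors 1 and 2 are attained for both \<open>p\<close>: the box, Assouad and lower
  dimensions agree. At \<open>\<theta> = 1/3\<close>, that is \<open>b = 3a\<close>, the extreme factors are attained only for \<open>p = 4\<close>.
\<close>

section \<open>Covering numbers\<close>

lemma covering_number_le:
  assumes "finite C" "E \<subseteq> (\<Union>c\<in>C. cball c r)"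
  shows "covering_number E r \<le> card C"
  unfolding covering_number_def using assms by (intro Least_le) blast

text \<open>The least number in \<open>covering_number\<close> is attained only if some finite cover
  exists; \<open>C0\<close> supplies one.\<close>

lemma optimal_cover:
  assumes "finite C0" "E \<subseteq> (\<Union>c\<in>C0. cball c r)"
  obtains C where "finite C" "card C = covering_number E r" "E \<subseteq> (\<Union>c\<in>C. cball c r)"
proof -
  have "\<exists>C. finite C \<and> card C = covering_number E r \<and> E \<subseteq> (\<Union>c\<in>C. cball c r)"
    unfolding covering_number_def
    by (rule LeastI_ex) (use assms in blast)
  then show ?thesis using that by blast
qed

lemma bounded_finite_cover:
  fixes E :: "'a::euclidean_space set"
  assumes "bounded E" "0 < r"
  obtains C where "finite C" "E \<subseteq> (\<Union>c\<in>C. cball c r)"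
proof -
  have "compact (closure E)" using assms(1) by simp
  then obtain C where "finite C" "closure E \<subseteq> (\<Union>x\<in>C. ball x r)"
    using assms(2) unfolding compact_eq_totally_bounded by blast
  moreover have "(\<Union>x\<in>C. ball x r) \<subseteq> (\<Union>c\<in>C. cball c r)"
    using ball_subset_cball by blast
  ultimately show ?thesis using that closure_subset by (meson order_trans)
qed

text \<open>A closed ball of radius \<open>r\<close> contains at most one point of a set whose
  points are more than \<open>2 * r\<close> apart, so assigning to each point a ball that covers it
  is injective.\<close>

lemma card_le_covering_number:
  fixes E :: "'a::euclidean_space set"
  assumes "S \<subseteq> E" "bounded E" "0 < r"
    and sep: "\<And>x y. x \<in> S \<Longrightarrow> y \<in> S \<Longrightarrow> x \<noteq> y \<Longrightarrow> 2 * r < dist x y"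
  shows "card S \<le> covering_number E r"
proof -
  obtain C0 where "finite C0" "E \<subseteq> (\<Union>c\<in>C0. cball c r)"
    using bounded_finite_cover[OF assms(2,3)] .
  then obtain C where C: "finite C" "card C = covering_number E r" "E \<subseteq> (\<Union>c\<in>C. cball c r)"
    by (rule optimal_cover)
  have "\<forall>x\<in>S. \<exists>c\<in>C. x \<in> cball c r" using C(3) assms(1) by blast
  then obtain f where f: "\<And>x. x \<in> S \<Longrightarrow> f x \<in> C" "\<And>x. x \<in> S \<Longrightarrow> dist (f x) x \<le> r"
    unfolding mem_cball by metis
  have "inj_on f S"
  proof (rule inj_onI, rule ccontr)
    fix x y assume xy: "x \<in> S" "y \<in> S" "f x = f y" "x \<noteq> y"
    have "dist x y \<le> dist (f x) x + dist (f y) y"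
      using xy(3) dist_triangle3[of x y "f x"] by simp
    then show False using f(2)[OF xy(1)] f(2)[OF xy(2)] sep[OF xy(1,2,4)] by linarith
  qed
  then show ?thesis using card_inj_on_le[of f S C] f(1) C(1,2) by auto
qed

text \<open>The map sends the ball into one of radius \<open>c * R\<close>, and a cover of the image
  is pulled back. Its centres must first be moved into \<open>E'\<close>, which doubles the
  radius.\<close>

lemma covering_number_bi_lipschitz:
  fixes E E' :: "'a::euclidean_space set"
  assumes bij: "bij_betw f E E'" and f: "c-lipschitz_on E f"
    and g: "c-lipschitz_on E' (inv_into E f)" and x: "x \<in> E" and r: "0 < r"
  shows "covering_number (cball x R \<inter> E) (2 * c * r) \<le> covering_number (cball (f x) (c * R) \<inter> E') r"
proof -
  have c: "0 \<le> c" using f lipschitz_on_nonneg by blast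
  have "bounded (cball (f x) (c * R) \<inter> E')" by (simp add: bounded_Int)
  then obtain C0 where "finite C0" "cball (f x) (c * R) \<inter> E' \<subseteq> (\<Union>c\<in>C0. cball c r)"
    using bounded_finite_cover r by blast
  then obtain C where C: "finite C" "card C = covering_number (cball (f x) (c * R) \<inter> E') r"
      "cball (f x) (c * R) \<inter> E' \<subseteq> (\<Union>c\<in>C. cball c r)"
    by (rule optimal_cover)
  define p where "p z = inv_into E f (SOME y. y \<in> cball z r \<inter> E')" for z
  have "cball x R \<inter> E \<subseteq> (\<Union>y\<in>p ` C. cball y (2 * c * r))"
  proof
    fix y assume y: "y \<in> cball x R \<inter> E"
    have fy: "f y \<in> E'" using bij y by (auto simp: bij_betw_def)
    have "dist (f x) (f y) \<le> c * dist x y" using lipschitz_onD[OF f x] y by blast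
    also have "\<dots> \<le> c * R" using y c by (intro mult_left_mono) auto
    finally have "f y \<in> cball (f x) (c * R) \<inter> E'" using fy by simp
    then obtain z where z: "z \<in> C" "f y \<in> cball z r" using C(3) by blast
    define w where "w = (SOME y. y \<in> cball z r \<inter> E')"
    have w: "w \<in> cball z r \<inter> E'" unfolding w_def by (rule someI[of _ "f y"]) (use z fy in blast)
    have "dist (p z) y = dist (inv_into E f w) (inv_into E f (f y))"
      unfolding p_def w_def using bij y by (simp add: bij_betw_inv_into_left)
    also have "\<dots> \<le> c * dist w (f y)" using lipschitz_onD[OF g] w fy by blast
    also have "\<dots> \<le> c * (2 * r)"
    proof (intro mult_left_mono c)
      have "dist w (f y) \<le> dist z w + dist z (f y)" by (rule dist_triangle3)
      then show "dist w (f y) \<le> 2 * r" using w z by auto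
    qed
    finally show "y \<in> (\<Union>y\<in>p ` C. cball y (2 * c * r))" using z(1) by (auto simp: algebra_simps)
  qed
  then have "covering_number (cball x R \<inter> E) (2 * c * r) \<le> card (p ` C)"
    using C(1) by (intro covering_number_le) auto
  also have "\<dots> \<le> card C" by (rule card_image_le[OF C(1)])
  finally show ?thesis using C(2) by simp
qed

section \<open>Coding map in coordinates\<close>

lemma word_map_nth:
  "word_map n \<omega> l x $ q = (\<Sum>k<l. real (\<omega> k q) / real (n q) ^ Suc k) + x $ q / real (n q) ^ l"
  by (induction l arbitrary: x) (simp_all add: digit_map_def add_divide_distrib)

lemma summable_digits:
  assumes n: "2 \<le> n" and d: "\<And>k. d k < (n::nat)"
  shows "summable (\<lambda>k. real (d k) / real n ^ Suc k)"
proof (rule summable_comparison_test')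
  show "summable (\<lambda>k. (1 / real n) ^ k)" using n by (intro summable_geometric) auto
  fix k
  have "real (d k) \<le> real n" using d[of k] by simp
  then show "norm (real (d k) / real n ^ Suc k) \<le> (1 / real n) ^ k"
    using n by (simp add: field_simps power_one_over)
qed

lemma suminf_digits:
  assumes n: "2 \<le> n" and d: "\<And>k. d k < (n::nat)"
  shows "0 \<le> (\<Sum>k. real (d k) / real n ^ Suc k)"
    and "(\<Sum>k. real (d k) / real n ^ Suc k) \<le> 1"
proof -
  show "0 \<le> (\<Sum>k. real (d k) / real n ^ Suc k)"
    by (intro suminf_nonneg summable_digits[OF assms]) simp
  \<comment> \<open>The term \<open>1 / real n ^ l\<close> is the mass left to the digits from
    position \<open>l\<close> on; keeping it makes the induction close.\<close>
  have p: "(\<Sum>k<l. real (d k) / real n ^ Suc k) \<le> 1 - 1 / real n ^ l" for l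
  proof (induction l)
    case (Suc l)
    have "real (d l) \<le> real n - 1" using d[of l] by linarith
    then have "real (d l) / real n ^ Suc l \<le> (real n - 1) / real n ^ Suc l"
      by (rule divide_right_mono) simp
    also have "\<dots> = 1 / real n ^ l - 1 / real n ^ Suc l" using n by (simp add: field_simps)
    finally show ?case using Suc by simp
  qed simp
  show "(\<Sum>k. real (d k) / real n ^ Suc k) \<le> 1"
  proof (rule suminf_le_const[OF summable_digits[OF assms]])
    fix l show "(\<Sum>k<l. real (d k) / real n ^ Suc k) \<le> 1"
      using p[of l] by (smt (verit) divide_nonneg_nonneg of_nat_0_le_iff zero_le_power)
  qed
qed

text \<open>The preimage of the expansion under \<open>word_map n \<omega> l\<close> is the
  expansion of the word shifted by \<open>l\<close>. Uniqueness holds because the boxes have side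
  \<open>1 / n q ^ l\<close> in coordinate \<open>q\<close>, which tends to 0.\<close>

lemma coding_map_eq:
  fixes n :: "'d::finite \<Rightarrow> nat"
  assumes n: "\<And>q. 2 \<le> n q" and d: "\<And>k. \<omega> k \<in> digit_box n"
  shows "coding_map n \<omega> = (\<chi> q. \<Sum>k. real (\<omega> k q) / real (n q) ^ Suc k)" (is "_ = ?x")
  unfolding coding_map_def
proof (rule the_equality)
  have lt: "\<omega> k q < n q" for k q using d by (auto simp: digit_box_def)
  show "?x \<in> (\<Inter>l. word_map n \<omega> l ` cbox 0 1)"
  proof (rule INT_I)
    fix l
    define y where "y = (\<chi> q. \<Sum>k. real (\<omega> (k + l) q) / real (n q) ^ Suc k)"
    have "?x = word_map n \<omega> l y"
    proof (rule vec_eq_iff[THEN iffD2], rule allI)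
      fix q
      have "(\<Sum>k. real (\<omega> k q) / real (n q) ^ Suc k) =
          (\<Sum>k. real (\<omega> (k + l) q) / real (n q) ^ Suc (k + l)) + (\<Sum>k<l. real (\<omega> k q) / real (n q) ^ Suc k)"
        by (rule suminf_split_initial_segment[OF summable_digits[OF n lt]])
      also have "(\<Sum>k. real (\<omega> (k + l) q) / real (n q) ^ Suc (k + l)) =
          (\<Sum>k. real (\<omega> (k + l) q) / real (n q) ^ Suc k / real (n q) ^ l)"
        by (simp add: power_add mult.assoc)
      also have "\<dots> = (\<Sum>k. real (\<omega> (k + l) q) / real (n q) ^ Suc k) / real (n q) ^ l"
        by (rule suminf_divide[OF summable_digits[OF n lt]])
      finally show "?x $ q = word_map n \<omega> l y $ q" by (simp add: word_map_nth y_def)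
    qed
    moreover have "y \<in> cbox 0 1"
      unfolding mem_box_cart y_def
      using suminf_digits[of "n _" "\<lambda>k. \<omega> (k + l) _", OF n lt] by simp
    ultimately show "?x \<in> word_map n \<omega> l ` cbox 0 1" by blast
  qed
next
  have lt: "\<omega> k q < n q" for k q using d by (auto simp: digit_box_def)
  fix z assume z: "z \<in> (\<Inter>l. word_map n \<omega> l ` cbox 0 1)"
  show "z = ?x"
  proof (rule vec_eq_iff[THEN iffD2], rule allI)
    fix q
    let ?S = "\<lambda>l. \<Sum>k<l. real (\<omega> k q) / real (n q) ^ Suc k"
    have b: "0 \<le> z $ q - ?S l \<and> z $ q - ?S l \<le> (1 / real (n q)) ^ l" for l
    proof -
      obtain y where y: "z = word_map n \<omega> l y" "y \<in> cbox 0 1" using z by blast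
      have yq: "0 \<le> y $ q" "y $ q \<le> 1" using y(2) by (auto simp: mem_box_cart)
      have "z $ q - ?S l = y $ q / real (n q) ^ l" using y(1) by (simp add: word_map_nth)
      then show ?thesis using yq by (simp add: power_one_over divide_right_mono)
    qed
    have lim: "(\<lambda>l. (1 / real (n q)) ^ l) \<longlonglongrightarrow> 0" using n[of q] by (intro LIMSEQ_realpow_zero) auto
    have "(\<lambda>l. z $ q - ?S l) \<longlonglongrightarrow> 0"
      by (rule tendsto_sandwich[OF _ _ tendsto_const lim]) (use b in auto)
    then have "(\<lambda>l. z $ q - (z $ q - ?S l)) \<longlonglongrightarrow> z $ q - 0" by (intro tendsto_intros)
    then have "?S \<longlonglongrightarrow> z $ q" by simp
    moreover have "?S \<longlonglongrightarrow> ?x $ q"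
      using summable_LIMSEQ[OF summable_digits[OF n lt]] by simp
    ultimately show "z $ q = ?x $ q" by (rule LIMSEQ_unique)
  qed
qed

section \<open>Cantor sets with digits 0 and 2\<close>

text \<open>A sequence of digits 0 and 2 is encoded by the set of positions of its 2s. Prefixes
  become intersections with initial segments, and counting words becomes counting subsets.\<close>

definition cantor_digit :: "nat \<Rightarrow> nat set \<Rightarrow> nat \<Rightarrow> real" where
  "cantor_digit m A k = (if k \<in> A then 2 else 0) / real m ^ Suc k"

definition cantor_point :: "nat \<Rightarrow> nat set \<Rightarrow> real" where
  "cantor_point m A = (\<Sum>k. cantor_digit m A k)"

lemma cantor_digit_alt: "cantor_digit m A k = real (if k \<in> A then 2 else 0) / real m ^ Suc k"
  by (simp add: cantor_digit_def)

lemma cantor_point_bounds: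
  assumes "3 \<le> m"
  shows "0 \<le> cantor_point m A" "cantor_point m A \<le> 1"
  unfolding cantor_point_def cantor_digit_alt
  by (rule suminf_digits; use assms in simp)+

text \<open>Self-similarity of the Cantor set: deleting the first digit shifts the address. The two
  distance estimates below are inductions along this identity.\<close>

lemma cantor_point_rec:
  assumes "3 \<le> m"
  shows "cantor_point m A = ((if 0 \<in> A then 2 else 0) + cantor_point m {k. Suc k \<in> A}) / m"
proof -
  have s: "summable (cantor_digit m B)" for B
    unfolding cantor_digit_alt by (rule summable_digits) (use assms in auto)
  have "cantor_digit m A (Suc k) = cantor_digit m {k. Suc k \<in> A} k / m" for k
    by (simp add: cantor_digit_def)
  then have "(\<Sum>k. cantor_digit m A (Suc k)) = cantor_point m {k. Suc k \<in> A} / m"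
    unfolding cantor_point_def using suminf_divide[OF s, of "{k. Suc k \<in> A}"] by simp
  then show ?thesis
    using suminf_split_head[OF s, of A]
    by (simp add: cantor_point_def cantor_digit_def[of _ _ 0] add_divide_distrib)
qed

lemma Int_lessThan_Suc_iff:
  "A \<inter> {..<Suc k} = B \<inter> {..<Suc k} \<longleftrightarrow>
     (0 \<in> A \<longleftrightarrow> 0 \<in> B) \<and> {i. Suc i \<in> A} \<inter> {..<k} = {i. Suc i \<in> B} \<inter> {..<k}"
proof -
  have "A \<inter> {..<Suc k} = B \<inter> {..<Suc k} \<longleftrightarrow> (\<forall>i<Suc k. i \<in> A \<longleftrightarrow> i \<in> B)" by auto
  also have "\<dots> \<longleftrightarrow> (0 \<in> A \<longleftrightarrow> 0 \<in> B) \<and> (\<forall>i<k. Suc i \<in> A \<longleftrightarrow> Suc i \<in> B)"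
    by (simp add: All_less_Suc2)
  also have "\<dots> \<longleftrightarrow> (0 \<in> A \<longleftrightarrow> 0 \<in> B) \<and> {i. Suc i \<in> A} \<inter> {..<k} = {i. Suc i \<in> B} \<inter> {..<k}"
    by auto
  finally show ?thesis .
qed

text \<open>Equal first digits cancel and leave the difference of the shifted points, scaled by
  \<open>1 / m\<close>. For \<open>k = 0\<close> both points lie in the unit interval.\<close>

lemma cantor_point_diff_le:
  assumes m: "3 \<le> m"
  shows "A \<inter> {..<k} = B \<inter> {..<k} \<Longrightarrow> \<bar>cantor_point m A - cantor_point m B\<bar> \<le> (1 / m) ^ k"
proof (induction k arbitrary: A B)
  case 0
  show ?case using cantor_point_bounds[OF m, of A] cantor_point_bounds[OF m, of B] by simp
next
  case (Suc k)
  let ?A = "{i. Suc i \<in> A}" and ?B = "{i. Suc i \<in> B}"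
  have eq: "0 \<in> A \<longleftrightarrow> 0 \<in> B" "?A \<inter> {..<k} = ?B \<inter> {..<k}"
    using Suc.prems Int_lessThan_Suc_iff by auto
  have "\<bar>cantor_point m A - cantor_point m B\<bar> = \<bar>cantor_point m ?A - cantor_point m ?B\<bar> / m"
    unfolding cantor_point_rec[OF m, of A] cantor_point_rec[OF m, of B] using eq(1)
    by (simp add: diff_divide_distrib[symmetric])
  also have "\<dots> \<le> (1 / m) ^ k / m" using Suc.IH[OF eq(2)] by (rule divide_right_mono) simp
  finally show ?case by simp
qed

text \<open>The digits 0 and 2 leave a gap: at the first disagreement the digits differ by 2 while
  the tails lie in \<open>[0, 1]\<close>, so a difference of at least 1 survives before
  scaling.\<close>

lemma cantor_point_diff_ge:
  assumes m: "3 \<le> m"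
  shows "A \<inter> {..<k} \<noteq> B \<inter> {..<k} \<Longrightarrow> (1 / m) ^ k \<le> \<bar>cantor_point m A - cantor_point m B\<bar>"
proof (induction k arbitrary: A B)
  case (Suc k)
  let ?A = "{i. Suc i \<in> A}" and ?B = "{i. Suc i \<in> B}"
  show ?case
  proof (cases "0 \<in> A \<longleftrightarrow> 0 \<in> B")
    case True
    then have "?A \<inter> {..<k} \<noteq> ?B \<inter> {..<k}" using Suc.prems Int_lessThan_Suc_iff by auto
    then have "(1 / m) ^ k / m \<le> \<bar>cantor_point m ?A - cantor_point m ?B\<bar> / m"
      by (intro divide_right_mono Suc.IH) auto
    also have "\<dots> = \<bar>cantor_point m A - cantor_point m B\<bar>"
      unfolding cantor_point_rec[OF m, of A] cantor_point_rec[OF m, of B] using True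
      by (simp add: diff_divide_distrib[symmetric])
    finally show ?thesis by simp
  next
    case False
    have "(1 / real m) ^ Suc k \<le> 1 / m" using m power_decreasing[of 1 "Suc k" "1 / real m"] by simp
    also have "\<dots> \<le> \<bar>(if 0 \<in> A then 2 else 0) + cantor_point m ?A -
        ((if 0 \<in> B then 2 else 0) + cantor_point m ?B)\<bar> / m"
      using False cantor_point_bounds[OF m, of ?A] cantor_point_bounds[OF m, of ?B]
      by (intro divide_right_mono) (auto split: if_splits)
    also have "\<dots> = \<bar>cantor_point m A - cantor_point m B\<bar>"
      unfolding cantor_point_rec[OF m, of A] cantor_point_rec[OF m, of B]
      by (simp add: diff_divide_distrib[symmetric])
    finally show ?thesis .
  qed
qed simp

section \<open>The two sponges\<close>

text \<open>All three bases have 256 as a power, so an approximate cube of side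
  \<open>256^-a\<close> fixes a whole number of letters in each coordinate and involves no
  rounding.\<close>

definition grid :: "3 \<Rightarrow> nat" where
  "grid q = (if q = 0 then 4 else if q = 1 then 16 else 256)"

definition depth :: "3 \<Rightarrow> nat" where
  "depth q = (if q = 0 then 4 else if q = 1 then 2 else 1)"

text \<open>Only the digits 0 and 2 occur in each coordinate. A word is encoded by the sets \<open>A q\<close> of the
  positions at which its \<open>q\<close>-th coordinate is 2. Since \<open>grid q ^ depth q = 256\<close>, \<open>trunc a\<close> retains
  exactly the information that determines the approximate cube of side \<open>256\<^sup>-\<^sup>a\<close>.\<close>

definition digits :: "3 \<Rightarrow> (3 \<Rightarrow> nat) set" where
  "digits j = {i. (\<forall>q. i q = 0 \<or> i q = 2) \<and> (i 2 = 2 \<longrightarrow> i j = 2)}"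

definition addresses :: "3 \<Rightarrow> (3 \<Rightarrow> nat set) set" where
  "addresses j = {A. A 2 \<subseteq> A j}"

definition point :: "(3 \<Rightarrow> nat set) \<Rightarrow> real ^ 3" where
  "point A = (\<chi> q. cantor_point (grid q) (A q))"

definition trunc :: "nat \<Rightarrow> (3 \<Rightarrow> nat set) \<Rightarrow> 3 \<Rightarrow> nat set" where
  "trunc a A = (\<lambda>q. A q \<inter> {..<depth q * a})"

lemma cases_3: obtains "q = 0" | "q = 1" | "q = (2::3)"
  using exhaust_3[of q] by auto

lemma three_distinct [simp]: "(0::3) \<noteq> 1" "(0::3) \<noteq> 2" "(1::3) \<noteq> 2" "(1::3) \<noteq> 0" "(2::3) \<noteq> 0" "(2::3) \<noteq> 1"
  using order_3 by auto

lemma grid_power_depth [simp]: "grid q ^ depth q = 256"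
  by (rule cases_3[of q]) (simp_all add: grid_def depth_def)

lemma grid_ge: "3 \<le> grid q"
  by (simp add: grid_def)

lemma depth_pos: "1 \<le> depth q"
  by (simp add: depth_def)

lemma grid_power: "(1 / real (grid q)) ^ (depth q * a) = (1 / 256) ^ a"
  by (metis grid_power_depth of_nat_numeral of_nat_power power_mult power_one_over)

lemma digits_subset: "digits j \<subseteq> digit_box grid"
proof
  fix i assume "i \<in> digits j"
  then have "i q = 0 \<or> i q = 2" for q by (simp add: digits_def)
  then have "i q \<le> 2" for q by (metis le_refl zero_le)
  then have "i q < grid q" for q using grid_ge[of q] by (metis less_le_trans numeral_3_eq_3 numeral_2_eq_2 less_Suc_eq_le)
  then show "i \<in> digit_box grid" by (simp add: digit_box_def)
qed

lemma sponge_digits: "sponge grid (digits j) = point ` addresses j"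
proof -
  have eq: "coding_map grid \<omega> = point (\<lambda>q. {k. \<omega> k q = 2})" if "\<And>k. \<omega> k \<in> digits j" for \<omega>
  proof -
    have "coding_map grid \<omega> = (\<chi> q. \<Sum>k. real (\<omega> k q) / real (grid q) ^ Suc k)"
    proof (rule coding_map_eq)
      show "2 \<le> grid q" for q using grid_ge[of q] by simp
      show "\<omega> k \<in> digit_box grid" for k using that digits_subset by blast
    qed
    also have "\<dots> = point (\<lambda>q. {k. \<omega> k q = 2})"
    proof -
      have "real (\<omega> k q) = (if \<omega> k q = 2 then 2 else 0)" for k q
        using that[of k] by (auto simp: digits_def)
      then show ?thesis by (simp add: point_def cantor_point_def cantor_digit_def)
    qed
    finally show ?thesis .
  qed
  show ?thesis
  proof
    show "sponge grid (digits j) \<subseteq> point ` addresses j"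
    proof
      fix x assume "x \<in> sponge grid (digits j)"
      then obtain \<omega> where w: "x = coding_map grid \<omega>" "\<And>k. \<omega> k \<in> digits j"
        by (auto simp: sponge_def)
      have "(\<lambda>q. {k. \<omega> k q = 2}) \<in> addresses j"
        using w(2) by (auto simp: addresses_def digits_def)
      then show "x \<in> point ` addresses j" using w eq by blast
    qed
  next
    show "point ` addresses j \<subseteq> sponge grid (digits j)"
    proof
      fix x assume "x \<in> point ` addresses j"
      then obtain A where A: "x = point A" "A 2 \<subseteq> A j" by (auto simp: addresses_def)
      define \<omega> where "\<omega> = (\<lambda>k q. if k \<in> A q then 2 else 0 :: nat)"
      have w: "\<omega> k \<in> digits j" for k using A(2) by (auto simp: \<omega>_def digits_def)
      have "(\<lambda>q. {k. \<omega> k q = 2}) = A" by (auto simp: \<omega>_def fun_eq_iff)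
      then have "x = coding_map grid \<omega>" using eq[of \<omega>] w A(1) by simp
      then show "x \<in> sponge grid (digits j)" using w by (auto simp: sponge_def)
    qed
  qed
qed

section \<open>Truncated addresses and distances between points\<close>

lemma trunc_trunc: "a \<le> b \<Longrightarrow> trunc a (trunc b A) = trunc a A"
proof
  fix q assume "a \<le> b"
  then have "{..<depth q * b} \<inter> {..<depth q * a} = {..<depth q * a}"
    by (intro Int_absorb1) simp
  then show "trunc a (trunc b A) q = trunc a A q" by (simp add: trunc_def Int_assoc)
qed

lemma trunc_0 [simp]: "trunc 0 A = (\<lambda>_. {})"
  by (simp add: trunc_def)

text \<open>Coordinate 2 has the smallest depth, so whenever one of its letters is retained, the
  letter of coordinate \<open>j\<close> that controls it is retained too.\<close>

lemma trunc_addresses: "A \<in> addresses j \<Longrightarrow> trunc b A \<in> addresses j"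
proof -
  assume A: "A \<in> addresses j"
  have "{..<depth 2 * b} \<subseteq> {..<depth j * b}"
    using mult_le_mono1[OF depth_pos[of j], of b] by (simp add: depth_def[of 2])
  moreover have "A 2 \<subseteq> A j" using A by (simp add: addresses_def)
  ultimately have "A 2 \<inter> {..<depth 2 * b} \<subseteq> A j \<inter> {..<depth j * b}" by (rule Int_mono[rotated])
  then show ?thesis by (simp add: addresses_def trunc_def)
qed

text \<open>The Euclidean norm is bounded by the sum over the three coordinates, whence the factor
  3.\<close>

lemma dist_point_le:
  assumes "trunc a A = trunc a B"
  shows "dist (point A) (point B) \<le> 3 * (1 / 256) ^ a"
proof -
  have "dist (point A) (point B) \<le> (\<Sum>q\<in>UNIV. \<bar>(point A - point B) $ q\<bar>)"
    unfolding dist_norm by (rule norm_le_l1_cart)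
  also have "\<dots> \<le> (\<Sum>q\<in>(UNIV::3 set). (1 / 256) ^ a)"
  proof (rule sum_mono)
    fix q :: 3
    have "A q \<inter> {..<depth q * a} = B q \<inter> {..<depth q * a}"
      using assms by (simp add: trunc_def fun_eq_iff)
    from cantor_point_diff_le[OF grid_ge[of q] this]
    show "\<bar>(point A - point B) $ q\<bar> \<le> (1 / 256) ^ a"
      unfolding grid_power by (simp add: point_def)
  qed
  finally show ?thesis by simp
qed

text \<open>One coordinate in which the truncations differ suffices. Together with the upper bound,
  this makes approximate cubes and balls interchangeable up to constants.\<close>

lemma dist_point_ge:
  assumes "trunc a A \<noteq> trunc a B"
  shows "(1 / 256) ^ a \<le> dist (point A) (point B)"
proof -
  obtain q where "A q \<inter> {..<depth q * a} \<noteq> B q \<inter> {..<depth q * a}"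
    using assms by (auto simp: trunc_def fun_eq_iff)
  from cantor_point_diff_ge[OF grid_ge[of q] this]
  have "(1 / 256) ^ a \<le> \<bar>(point A - point B) $ q\<bar>"
    unfolding grid_power by (simp add: point_def)
  also have "\<dots> \<le> dist (point A) (point B)"
    unfolding dist_norm by (rule component_le_norm_cart)
  finally show ?thesis .
qed

lemma trunc_eqI: "dist (point A) (point B) < (1 / 256) ^ a \<Longrightarrow> trunc a A = trunc a B"
  using dist_point_ge[of a A B] by linarith

lemma inj_point: "inj point"
proof (rule injI)
  fix A B assume "point A = point B"
  then have t: "trunc a A = trunc a B" for a by (intro trunc_eqI) simp
  have "k \<in> A q \<longleftrightarrow> k \<in> B q" for k q
  proof -
    \<comment> \<open>Every depth is at least 1, so position \<open>k\<close> survives truncation at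
      level \<open>Suc k\<close>.\<close>
    have "k \<in> A q \<longleftrightarrow> k \<in> trunc (Suc k) A q" "k \<in> B q \<longleftrightarrow> k \<in> trunc (Suc k) B q"
      using mult_le_mono1[OF depth_pos[of q], of "Suc k"] by (auto simp: trunc_def)
    then show ?thesis using t by simp
  qed
  then show "A = B" by (simp add: fun_eq_iff set_eq_iff)
qed

lemma bounded_points: "bounded (point ` X)"
proof -
  have "point A \<in> cball (point (\<lambda>_. {})) 3" for A
    using dist_point_le[of 0 "\<lambda>_. {}" A] by simp
  then have "point ` X \<subseteq> cball (point (\<lambda>_. {})) 3" by blast
  then show ?thesis using bounded_cball bounded_subset by blast
qed

section \<open>Cylinders\<close>

definition cylinder :: "3 \<Rightarrow> nat \<Rightarrow> (3 \<Rightarrow> nat set) \<Rightarrow> (3 \<Rightarrow> nat set) set" where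
  "cylinder j a A = {B \<in> addresses j. trunc a B = trunc a A}"

text \<open>This counts the approximate cubes of side \<open>256^-b\<close> that meet the sponge
  inside the cube of side \<open>256^-a\<close> around \<open>point A\<close>, each represented by
  its truncated address.\<close>

definition descendants :: "3 \<Rightarrow> nat \<Rightarrow> nat \<Rightarrow> (3 \<Rightarrow> nat set) \<Rightarrow> nat" where
  "descendants j a b A = card (trunc b ` cylinder j a A)"

lemma cylinder_0: "cylinder j 0 A = addresses j"
  by (simp add: cylinder_def)

lemma finite_trunc_image: "finite (trunc b ` X)"
proof -
  have "trunc b ` X \<subseteq> Pi\<^sub>E UNIV (\<lambda>q. Pow {..<depth q * b})"
    by (auto simp: trunc_def PiE_def)
  moreover have "finite (Pi\<^sub>E (UNIV :: 3 set) (\<lambda>q. Pow {..<depth q * b}))"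
    by (intro finite_PiE) auto
  ultimately show ?thesis by (rule finite_subset)
qed

text \<open>One ball per approximate cube of level \<open>b\<close>, centred at the point whose
  address is cut off at that level, covers the cube.\<close>

lemma covering_number_cylinder_le:
  assumes "E \<subseteq> point ` cylinder j a A" "3 * (1 / 256) ^ b \<le> r"
  shows "covering_number E r \<le> descendants j a b A"
proof -
  let ?T = "trunc b ` cylinder j a A"
  have "E \<subseteq> (\<Union>c\<in>point ` ?T. cball c r)"
  proof
    fix x assume "x \<in> E"
    then obtain B where B: "B \<in> cylinder j a A" "x = point B" using assms(1) by blast
    have "dist (point (trunc b B)) x \<le> 3 * (1 / 256) ^ b"
      unfolding B(2) by (rule dist_point_le) (simp add: trunc_trunc)
    then show "x \<in> (\<Union>c\<in>point ` ?T. cball c r)" using assms(2) B(1) by (auto intro!: bexI[of _ B])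
  qed
  then have "covering_number E r \<le> card (point ` ?T)"
    by (intro covering_number_le finite_imageI finite_trunc_image)
  also have "\<dots> \<le> card ?T" by (rule card_image_le[OF finite_trunc_image])
  finally show ?thesis by (simp add: descendants_def)
qed

text \<open>Continuing a truncated address by zeros stays in the cylinder, so the truncations are
  themselves addresses of points of the sponge.\<close>

lemma trunc_image_cylinder:
  assumes "a \<le> b"
  shows "trunc b ` cylinder j a A = {B \<in> cylinder j a A. trunc b B = B}"
proof
  show "trunc b ` cylinder j a A \<subseteq> {B \<in> cylinder j a A. trunc b B = B}"
    using assms by (auto simp: cylinder_def trunc_trunc trunc_addresses)
  show "{B \<in> cylinder j a A. trunc b B = B} \<subseteq> trunc b ` cylinder j a A"
    by force
qed

text \<open>The points with addresses cut off at level \<open>b\<close> are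
  \<open>(1 / 256) ^ b\<close> apart, and one ball of radius \<open>r\<close> cannot cover two of
  them.\<close>

lemma covering_number_cylinder_ge:
  assumes "point ` cylinder j a A \<subseteq> E" "bounded E" "0 < r" "2 * r < (1 / 256) ^ b" "a \<le> b"
  shows "descendants j a b A \<le> covering_number E r"
proof -
  let ?T = "trunc b ` cylinder j a A"
  have T: "?T = {B \<in> cylinder j a A. trunc b B = B}" by (rule trunc_image_cylinder[OF assms(5)])
  have "card (point ` ?T) \<le> covering_number E r"
  proof (rule card_le_covering_number[OF _ assms(2,3)])
    show "point ` ?T \<subseteq> E" using assms(1) T by blast
    fix x y assume "x \<in> point ` ?T" "y \<in> point ` ?T" "x \<noteq> y"
    then obtain B C where BC: "x = point B" "y = point C" "B \<in> ?T" "C \<in> ?T" by (metis (no_types, lifting) imageE)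
    have "trunc b B = B" "trunc b C = C" using BC(3,4) unfolding T by auto
    moreover have "B \<noteq> C" using \<open>x \<noteq> y\<close> BC(1,2) by blast
    ultimately have "(1 / 256) ^ b \<le> dist x y" unfolding BC(1,2) by (intro dist_point_ge) simp
    then show "2 * r < dist x y" using assms(4) by linarith
  qed
  then show ?thesis by (simp add: descendants_def card_image inj_on_subset[OF inj_point])
qed

lemma ball_subset_cylinder:
  assumes "R < (1 / 256) ^ a"
  shows "cball (point A) R \<inter> point ` addresses j \<subseteq> point ` cylinder j a A"
proof
  fix x assume "x \<in> cball (point A) R \<inter> point ` addresses j"
  then obtain B where B: "x = point B" "B \<in> addresses j" "dist (point A) (point B) \<le> R" by auto
  then have "trunc a A = trunc a B" using assms by (intro trunc_eqI) linarith
  then show "x \<in> point ` cylinder j a A" using B by (auto simp: cylinder_def)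
qed

lemma cylinder_subset_ball:
  assumes "3 * (1 / 256) ^ a \<le> R"
  shows "point ` cylinder j a A \<subseteq> cball (point A) R \<inter> point ` addresses j"
proof
  fix x assume "x \<in> point ` cylinder j a A"
  then obtain B where B: "x = point B" "B \<in> addresses j" "trunc a A = trunc a B"
    by (auto simp: cylinder_def)
  then show "x \<in> cball (point A) R \<inter> point ` addresses j"
    using dist_point_le[OF B(3)] assms by auto
qed

section \<open>Counting cylinders\<close>

lemma extensions_eq:
  assumes "(k::nat) \<le> m"
  shows "{Y. Y \<subseteq> {..<m} \<and> Y \<inter> {..<k} = Z \<inter> {..<k}} = (\<lambda>T. (Z \<inter> {..<k}) \<union> T) ` Pow {k..<m}"
    (is "?L = ?R")
proof
  show "?L \<subseteq> ?R"
  proof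
    fix Y assume Y: "Y \<in> ?L"
    then have "\<forall>i\<in>Y. i < m" by blast
    then have "Y = (Y \<inter> {..<k}) \<union> (Y \<inter> {k..<m})" by auto
    also have "Y \<inter> {..<k} = Z \<inter> {..<k}" using Y by simp
    finally show "Y \<in> ?R" by blast
  qed
  show "?R \<subseteq> ?L"
  proof
    fix Y assume "Y \<in> ?R"
    then obtain T where T: "T \<subseteq> {k..<m}" "Y = (Z \<inter> {..<k}) \<union> T" by auto
    have "T \<inter> {..<k} = {}" "T \<subseteq> {..<m}" using T(1) by auto
    then show "Y \<in> ?L" using T(2) assms by auto
  qed
qed

lemma inj_on_extensions: "inj_on (\<lambda>T. (Z \<inter> {..<k::nat}) \<union> T) (Pow {k..<m})"
proof (rule inj_onI)
  fix S T assume "S \<in> Pow {k..<m}" "T \<in> Pow {k..<m}" "Z \<inter> {..<k} \<union> S = Z \<inter> {..<k} \<union> T"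
  moreover from this have "S = (Z \<inter> {..<k} \<union> S) - {..<k}" "T = (Z \<inter> {..<k} \<union> T) - {..<k}" by auto
  ultimately show "S = T" by simp
qed

lemma card_extensions:
  assumes "(k::nat) \<le> m"
  shows "card {Y. Y \<subseteq> {..<m} \<and> Y \<inter> {..<k} = Z \<inter> {..<k}} = 2 ^ (m - k)"
  unfolding extensions_eq[OF assms] card_image[OF inj_on_extensions] by (simp add: card_Pow)

text \<open>The prescribed prefix already lies in \<open>S\<close>, so the free choice is an
  arbitrary subset of \<open>S\<close> in the window from \<open>a\<close> to
  \<open>b\<close>.\<close>

lemma card_restricted_extensions:
  assumes "(a::nat) \<le> b" "W \<inter> {..<a} \<subseteq> S"
  shows "card {Y. Y \<subseteq> {..<b} \<and> Y \<inter> {..<a} = W \<inter> {..<a} \<and> Y \<subseteq> S} = 2 ^ card (S \<inter> {a..<b})"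
proof -
  have "{Y. Y \<subseteq> {..<b} \<and> Y \<inter> {..<a} = W \<inter> {..<a} \<and> Y \<subseteq> S} =
      {Y \<in> (\<lambda>T. (W \<inter> {..<a}) \<union> T) ` Pow {a..<b}. Y \<subseteq> S}"
    unfolding extensions_eq[OF assms(1), of W, symmetric] by simp
  also have "\<dots> = (\<lambda>T. (W \<inter> {..<a}) \<union> T) ` Pow (S \<inter> {a..<b})" using assms(2) by auto
  also have "card \<dots> = card (Pow (S \<inter> {a..<b}))"
    by (intro card_image inj_on_subset[OF inj_on_extensions]) auto
  also have "\<dots> = 2 ^ card (S \<inter> {a..<b})" by (rule card_Pow) simp
  finally show ?thesis .
qed

text \<open>The sum is an expanded product. A position outside \<open>T\<close> has weight 1, and
  one inside has weight 2 below \<open>b\<close> and 1 otherwise, so each position contributes a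
  factor 3 or 2.\<close>

lemma sum_Pow_power_card:
  "(\<Sum>T\<in>Pow {k..<m}. 2 ^ card (T \<inter> {k..<b})) = (3::nat) ^ (min m b - k) * 2 ^ (m - max k b)"
proof -
  have "(\<Sum>T\<in>Pow {k..<m}. 2 ^ card (T \<inter> {k..<b})) =
      (\<Sum>T\<in>Pow {k..<m}. (\<Prod>i\<in>T. if i < b then 2 else 1) * (\<Prod>i\<in>{k..<m} - T. 1::nat))"
  proof (rule sum.cong[OF refl])
    fix T assume T: "T \<in> Pow {k..<m}"
    then have "finite T" "T \<inter> {k..<b} = {i \<in> T. i < b}" by (auto intro: finite_subset)
    then show "2 ^ card (T \<inter> {k..<b}) = (\<Prod>i\<in>T. if i < b then 2 else 1) * (\<Prod>i\<in>{k..<m} - T. 1::nat)"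
      by (simp add: prod.If_cases Int_def)
  qed
  also have "\<dots> = (\<Prod>i\<in>{k..<m}. (if i < b then 2 else 1) + (1::nat))"
    by (rule prod_add[symmetric]) simp
  also have "\<dots> = (\<Prod>i\<in>{k..<m}. if i < b then 3 else 2)" by (rule prod.cong) auto
  also have "\<dots> = 3 ^ card ({k..<m} \<inter> {i. i < b}) * 2 ^ card ({k..<m} \<inter> - {i. i < b})"
    by (subst prod.If_cases) simp_all
  also have "{k..<m} \<inter> {i. i < b} = {k..<min m b}" by auto
  also have "{k..<m} \<inter> - {i. i < b} = {max k b..<m}" by auto
  finally show ?thesis by simp
qed

text \<open>\<open>Y\<close> is the word of the controlling coordinate, with prefix given by
  \<open>S\<close>, and \<open>Z\<close> that of the third coordinate, with prefix given by
  \<open>W\<close>. Positions of \<open>Z\<close> below \<open>p * a\<close> are controlled by fixed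
  letters of \<open>S\<close>; the later ones are controlled by new letters of \<open>Y\<close> and
  are summed over.\<close>

lemma card_pairs:
  assumes "a \<le> b" "1 \<le> p" "W \<inter> {..<a} \<subseteq> S"
  shows "card {(Y, Z). Y \<subseteq> {..<p * b} \<and> Y \<inter> {..<p * a} = S \<inter> {..<p * a} \<and>
      Z \<subseteq> {..<b} \<and> Z \<inter> {..<a} = W \<inter> {..<a} \<and> Z \<subseteq> Y} =
    2 ^ card (S \<inter> {a..<min b (p * a)}) * 3 ^ (b - p * a) * 2 ^ (p * b - max (p * a) b)"
proof -
  let ?Y = "{Y. Y \<subseteq> {..<p * b} \<and> Y \<inter> {..<p * a} = S \<inter> {..<p * a}}"
  let ?Z = "\<lambda>Y. {Z. Z \<subseteq> {..<b} \<and> Z \<inter> {..<a} = W \<inter> {..<a} \<and> Z \<subseteq> Y}"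
  have pa: "a \<le> p * a" "b \<le> p * b" "p * a \<le> p * b" using assms(1,2) by auto
  have "card {(Y, Z). Y \<subseteq> {..<p * b} \<and> Y \<inter> {..<p * a} = S \<inter> {..<p * a} \<and>
      Z \<subseteq> {..<b} \<and> Z \<inter> {..<a} = W \<inter> {..<a} \<and> Z \<subseteq> Y} = card (Sigma ?Y ?Z)"
    by (rule arg_cong[of _ _ card]) auto
  also have "\<dots> = (\<Sum>Y\<in>?Y. card (?Z Y))"
    by (rule card_SigmaI) (auto intro: finite_subset[of _ "Pow {..<p * b}"] finite_subset[of _ "Pow {..<b}"])
  also have "\<dots> = (\<Sum>Y\<in>?Y. 2 ^ card (Y \<inter> {a..<b}))"
  proof (rule sum.cong[OF refl])
    fix Y assume Y: "Y \<in> ?Y"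
    have "W \<inter> {..<a} \<subseteq> S \<inter> {..<p * a}" using assms(3) less_le_trans[OF _ pa(1)] by auto
    then have "W \<inter> {..<a} \<subseteq> Y" using Y by blast
    then show "card (?Z Y) = 2 ^ card (Y \<inter> {a..<b})" by (rule card_restricted_extensions[OF assms(1)])
  qed
  \<comment> \<open>\<open>Y\<close> is the fixed prefix together with a free set \<open>T\<close>
    of new positions.\<close>
  also have "\<dots> = (\<Sum>T\<in>Pow {p * a..<p * b}. 2 ^ card ((S \<inter> {..<p * a} \<union> T) \<inter> {a..<b}))"
    unfolding extensions_eq[OF pa(3)] by (subst sum.reindex[OF inj_on_extensions]) simp
  also have "\<dots> = (\<Sum>T\<in>Pow {p * a..<p * b}. 2 ^ card (S \<inter> {a..<min b (p * a)}) * 2 ^ card (T \<inter> {p * a..<b}))"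
  proof (rule sum.cong[OF refl])
    fix T assume T: "T \<in> Pow {p * a..<p * b}"
    have "(S \<inter> {..<p * a} \<union> T) \<inter> {a..<b} = S \<inter> {a..<min b (p * a)} \<union> T \<inter> {p * a..<b}"
      using T by (auto intro: order_trans[OF pa(1)])
    moreover have "card (S \<inter> {a..<min b (p * a)} \<union> T \<inter> {p * a..<b}) =
        card (S \<inter> {a..<min b (p * a)}) + card (T \<inter> {p * a..<b})"
      by (rule card_Un_disjoint) auto
    ultimately show "(2::nat) ^ card ((S \<inter> {..<p * a} \<union> T) \<inter> {a..<b}) =
        2 ^ card (S \<inter> {a..<min b (p * a)}) * 2 ^ card (T \<inter> {p * a..<b})"
      by (simp add: power_add)
  qed
  also have "\<dots> = 2 ^ card (S \<inter> {a..<min b (p * a)}) * (3 ^ (b - p * a) * 2 ^ (p * b - max (p * a) b))"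
    using pa(2) by (simp add: sum_distrib_left[symmetric] sum_Pow_power_card min_absorb2)
  finally show ?thesis by simp
qed

text \<open>The factors count, in this order, the two freely chosen coordinates, the third
  coordinate under letters already fixed, and the third coordinate under new letters. The last
  exponent is a truncated difference: it is 0 as long as \<open>b\<close> does not exceed
  \<open>depth j * a\<close>.\<close>

lemma descendants_eq:
  assumes ab: "a \<le> b" and j: "j \<noteq> 2" and A: "A \<in> addresses j"
  shows "real (descendants j a b A) =
    64 ^ (b - a) * 2 ^ card (A j \<inter> {a..<min b (depth j * a)}) * (3 / 2) ^ (b - depth j * a)"
proof -
  define i :: 3 where "i = (if j = 0 then 1 else 0)"
  have i: "i \<noteq> j" "i \<noteq> 2" "\<And>q. q = i \<or> q = j \<or> q = 2"
    using j cases_3[of j] cases_3 by (auto simp: i_def)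
  \<comment> \<open>Coordinates 0 and 1 gain 6 letters per level, which gives
    \<open>2 ^ 6 = 64\<close>.\<close>
  have dep: "depth i + depth j = 6"
    by (rule cases_3[of j]) (use j in \<open>auto simp: i_def depth_def\<close>)
  let ?p = "depth j"
  let ?U = "{Y. Y \<subseteq> {..<depth i * b} \<and> Y \<inter> {..<depth i * a} = A i \<inter> {..<depth i * a}}"
  let ?P = "{(Y, Z). Y \<subseteq> {..<?p * b} \<and> Y \<inter> {..<?p * a} = A j \<inter> {..<?p * a} \<and>
      Z \<subseteq> {..<b} \<and> Z \<inter> {..<a} = A 2 \<inter> {..<a} \<and> Z \<subseteq> Y}"
  let ?T = "trunc b ` cylinder j a A"
  have all3: "(\<forall>q. P q) \<longleftrightarrow> P i \<and> P j \<and> P 2" for P using i(3) by metis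
  have d2: "depth 2 = 1" by (simp add: depth_def)
  have T: "B \<in> ?T \<longleftrightarrow> B i \<in> ?U \<and> (B j, B 2) \<in> ?P" for B
  proof -
    have "B \<in> ?T \<longleftrightarrow> B 2 \<subseteq> B j \<and> (\<forall>q. B q \<inter> {..<depth q * a} = A q \<inter> {..<depth q * a}) \<and>
        (\<forall>q. B q \<subseteq> {..<depth q * b})"
      unfolding trunc_image_cylinder[OF ab]
      by (simp add: cylinder_def addresses_def trunc_def fun_eq_iff[where 'a = 3] inf.absorb_iff1)
    then show ?thesis unfolding all3 by (simp add: d2) blast
  qed
  have "bij_betw (\<lambda>B. (B i, B j, B 2)) ?T (?U \<times> ?P)"
  proof (rule bij_betwI')
    fix B C assume "B \<in> ?T" "C \<in> ?T"
    show "((B i, B j, B 2) = (C i, C j, C 2)) = (B = C)"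
      using all3[of "\<lambda>q. B q = C q"] by (simp add: fun_eq_iff[where 'a = 3])
  next
    fix B assume "B \<in> ?T" then show "(B i, B j, B 2) \<in> ?U \<times> ?P" using T by simp
  next
    fix z assume "z \<in> ?U \<times> ?P"
    then obtain X Y Z where z: "z = (X, Y, Z)" "X \<in> ?U" "(Y, Z) \<in> ?P" by (cases z) auto
    define B where "B = (\<lambda>q. if q = i then X else if q = j then Y else Z)"
    have B: "B i = X" "B j = Y" "B 2 = Z" using i(1,2) j by (simp_all add: B_def)
    then show "\<exists>B\<in>?T. z = (B i, B j, B 2)" using z T by (intro bexI[of _ B]) simp_all
  qed
  then have "descendants j a b A = card ?U * card ?P"
    unfolding descendants_def by (simp add: bij_betw_same_card card_cartesian_product)
  also have "\<dots> = 2 ^ (depth i * b - depth i * a) * (2 ^ card (A j \<inter> {a..<min b (?p * a)}) *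
      3 ^ (b - ?p * a) * 2 ^ (?p * b - max (?p * a) b))"
    using A ab by (subst card_extensions, simp, subst card_pairs) (use depth_pos[of j] in \<open>auto simp: addresses_def\<close>)
  finally have e: "real (descendants j a b A) = 2 ^ (depth i * b - depth i * a) *
      (2 ^ card (A j \<inter> {a..<min b (?p * a)}) * 3 ^ (b - ?p * a) * 2 ^ (?p * b - max (?p * a) b))"
    by simp
  have "b \<le> ?p * b" using depth_pos[of j] by simp
  moreover have "?p * a \<le> ?p * b" using ab by simp
  ultimately have "(?p * b - max (?p * a) b) + (b - ?p * a) = ?p * b - ?p * a" by linarith
  then have "(2::real) ^ (?p * b - max (?p * a) b) * 2 ^ (b - ?p * a) = 2 ^ (?p * b - ?p * a)"
    by (metis power_add)
  \<comment> \<open>Each 3 is split as \<open>2 * (3 / 2)\<close>: the 2 counts the controlling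
    letter, and \<open>3 / 2\<close> is the average contribution of the third coordinate.\<close>
  then have "(2::real) ^ (?p * b - max (?p * a) b) * 3 ^ (b - ?p * a) =
      2 ^ (?p * b - ?p * a) * (3 / 2) ^ (b - ?p * a)"
    by (simp add: power_divide field_simps)
  moreover have "(2::real) ^ (depth i * b - depth i * a) * 2 ^ (?p * b - ?p * a) = 64 ^ (b - a)"
  proof -
    have "(depth i * b - depth i * a) + (?p * b - ?p * a) = 6 * (b - a)"
      using dep by (metis add_mult_distrib diff_mult_distrib2)
    then have "(2::real) ^ (depth i * b - depth i * a) * 2 ^ (?p * b - ?p * a) = 2 ^ (6 * (b - a))"
      by (metis power_add)
    then show ?thesis by (simp add: power_mult)
  qed
  moreover have "u * (c * w * v) = (u * x) * c * y" if "v * w = x * y" for u c v w x y :: real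
    using that by (simp add: mult_ac)
  ultimately show ?thesis unfolding e by metis
qed

text \<open>Hence for \<open>b = 2 * a\<close> every controlling letter is already fixed, for both
  choices of \<open>j\<close>.\<close>

lemma depth_ge_2: "j \<noteq> 2 \<Longrightarrow> 2 \<le> depth j"
  by (rule cases_3[of j]) (simp_all add: depth_def)

lemma descendants_le:
  assumes "a \<le> b" "j \<noteq> 2" "A \<in> addresses j"
  shows "real (descendants j a b A) \<le> 128 ^ (b - a)"
proof -
  let ?m = "min b (depth j * a) - a" and ?k = "b - depth j * a"
  have "card (A j \<inter> {a..<min b (depth j * a)}) \<le> card {a..<min b (depth j * a)}"
    by (intro card_mono) auto
  then have "(2::real) ^ card (A j \<inter> {a..<min b (depth j * a)}) \<le> 2 ^ ?m"
    by (intro power_increasing) auto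
  moreover have "(3 / 2 :: real) ^ ?k \<le> 2 ^ ?k" by (intro power_mono) auto
  ultimately have "(2::real) ^ card (A j \<inter> {a..<min b (depth j * a)}) * (3 / 2) ^ ?k \<le> 2 ^ ?m * 2 ^ ?k"
    by (intro mult_mono) auto
  also have "\<dots> = 2 ^ (b - a)"
  proof -
    have "a \<le> depth j * a" using depth_pos[of j] by simp
    then have "?m + ?k = b - a" using assms(1) by linarith
    then show ?thesis by (metis power_add)
  qed
  finally have "64 ^ (b - a) * ((2::real) ^ card (A j \<inter> {a..<min b (depth j * a)}) * (3 / 2) ^ ?k) \<le>
      64 ^ (b - a) * 2 ^ (b - a)"
    by (intro mult_left_mono) auto
  also have "\<dots> = 128 ^ (b - a)" by (simp add: power_mult_distrib[symmetric])
  finally show ?thesis unfolding descendants_eq[OF assms] by (simp only: mult.assoc)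
qed

text \<open>The letters that fixed ones control may all be forced to 0, but the average
  \<open>3 / 2\<close> over new controlling letters is gained in every cylinder.\<close>

lemma descendants_ge:
  assumes "a \<le> b" "j \<noteq> 2" "A \<in> addresses j"
  shows "64 ^ (b - a) * (3 / 2) ^ (b - depth j * a) \<le> real (descendants j a b A)"
proof -
  have "(1::real) \<le> 2 ^ card (A j \<inter> {a..<min b (depth j * a)})" by (rule one_le_power) simp
  then have "(64::real) ^ (b - a) * 1 * (3 / 2) ^ (b - depth j * a) \<le>
      64 ^ (b - a) * 2 ^ card (A j \<inter> {a..<min b (depth j * a)}) * (3 / 2) ^ (b - depth j * a)"
    by (intro mult_right_mono mult_left_mono) auto
  then show ?thesis unfolding descendants_eq[OF assms] by simp
qed

section \<open>Extreme and average numbers of descendants\<close>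

lemma UNIV_address: "(\<lambda>_. UNIV) \<in> addresses j"
  and empty_address: "(\<lambda>_. {}) \<in> addresses j"
  by (simp_all add: addresses_def)

lemma descendants_UNIV:
  assumes "a \<le> b" "j \<noteq> 2" "b \<le> depth j * a"
  shows "real (descendants j a b (\<lambda>_. UNIV)) = 128 ^ (b - a)"
  unfolding descendants_eq[OF assms(1,2) UNIV_address] using assms(3)
  by (simp add: power_mult_distrib[symmetric] min_absorb1)

lemma descendants_empty:
  assumes "a \<le> b" "j \<noteq> 2" "b \<le> depth j * a"
  shows "real (descendants j a b (\<lambda>_. {})) = 64 ^ (b - a)"
  unfolding descendants_eq[OF assms(1,2) empty_address] using assms(3) by simp

text \<open>Nothing is fixed at level 0, so each level contributes \<open>64 * (3 / 2) = 96\<close>,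
  whichever coordinate controls.\<close>

lemma descendants_0:
  assumes "j \<noteq> 2" "A \<in> addresses j"
  shows "real (descendants j 0 b A) = 96 ^ b"
  unfolding descendants_eq[OF le0 assms] by (simp add: power_mult_distrib[symmetric])

text \<open>With depth 2, fixed letters control only the \<open>a\<close> positions from
  \<open>a\<close> to \<open>2 * a\<close>; only these can contribute a full factor 2. This bound is
  what separates the two sponges.\<close>

lemma descendants_1_le:
  assumes "2 * a \<le> b" "A \<in> addresses 1"
  shows "real (descendants 1 a b A) \<le> 64 ^ (b - a) * 2 ^ a * (3 / 2) ^ (b - 2 * a)"
proof -
  have ab: "a \<le> b" using assms(1) by simp
  have "card (A 1 \<inter> {a..<min b (depth 1 * a)}) \<le> card {a..<min b (depth 1 * a)}"
    by (intro card_mono) auto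
  also have "\<dots> = a" using assms(1) by (simp add: depth_def)
  finally have "(2::real) ^ card (A 1 \<inter> {a..<min b (depth 1 * a)}) \<le> 2 ^ a"
    by (intro power_increasing) auto
  then have "64 ^ (b - a) * (2::real) ^ card (A 1 \<inter> {a..<min b (depth 1 * a)}) * (3 / 2) ^ (b - depth 1 * a)
      \<le> 64 ^ (b - a) * 2 ^ a * (3 / 2) ^ (b - depth 1 * a)"
    by (intro mult_right_mono mult_left_mono) auto
  then show ?thesis
    unfolding descendants_eq[OF ab three_distinct(3) assms(2)] by (simp add: depth_def[of 1])
qed

section \<open>Scales and exponents\<close>

text \<open>A large radius gets \<open>a = 0\<close> and no upper bound, which fits the fact that
  the cylinder of level 0 is the whole sponge.\<close>

lemma scale_exists:
  fixes R :: real
  assumes "0 < R"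
  obtains a where "(1 / 256) ^ Suc a \<le> R" "a = 0 \<or> R < (1 / 256) ^ a"
proof -
  obtain k where "(1 / 256 :: real) ^ k < R" using real_arch_pow_inv[of R "1 / 256"] assms by auto
  moreover have "(1 / 256 :: real) ^ Suc k \<le> (1 / 256) ^ k" by simp
  ultimately have ex: "(1 / 256 :: real) ^ Suc k \<le> R" by linarith
  define a where "a = (LEAST a. (1 / 256 :: real) ^ Suc a \<le> R)"
  have le: "(1 / 256) ^ Suc a \<le> R" unfolding a_def by (rule LeastI[of _ k]) (rule ex)
  have lt: "a = 0 \<or> R < (1 / 256) ^ a"
  proof (cases a)
    case (Suc b)
    then have "b < a" by simp
    then have "\<not> (1 / 256 :: real) ^ Suc b \<le> R" unfolding a_def by (rule not_less_Least)
    then show ?thesis using Suc by simp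
  qed simp
  show ?thesis by (rule that[OF le lt])
qed

text \<open>One further level absorbs the constant 3 from the diameter of the approximate
  cubes.\<close>

lemma three_scales: "(1 / 256) ^ Suc a \<le> R \<Longrightarrow> 3 * (1 / 256) ^ (a + 2) \<le> R" for R :: real
proof -
  assume "(1 / 256) ^ Suc a \<le> R"
  moreover have "0 \<le> (1 / 256 :: real) ^ a" by simp
  ultimately show ?thesis by (simp del: zero_le_power zero_le_divide_iff)
qed

lemma power_powr: "0 < x \<Longrightarrow> (x ^ k) powr s = (x powr s) ^ k" for x :: real
  by (induction k) (simp_all add: powr_mult)

text \<open>Constants do not affect exponential growth rates. All bounds on admissible exponents are
  reduced to this comparison.\<close>

lemma le_if_power_le_const_mult:
  fixes x y C :: real
  assumes "\<And>k. x ^ k \<le> C * y ^ k" "0 < y"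
  shows "x \<le> y"
proof (rule ccontr)
  assume "\<not> x \<le> y"
  then have "1 < x / y" using assms(2) by simp
  then obtain k where "C < (x / y) ^ k" using real_arch_pow by blast
  then have "C * y ^ k < x ^ k" using assms(2) by (simp add: power_divide field_simps)
  then show False using assms(1)[of k] by simp
qed

text \<open>The ratio \<open>R / r\<close> equals \<open>256 ^ (b - a)\<close> up to a factor 256.
  Its upper bound asks for \<open>R < 1\<close>, since the level \<open>a = 0\<close> does not bound
  \<open>R\<close>.\<close>

lemma scale_pair:
  fixes r R :: real
  assumes "0 < r" "r < R"
  obtains a b where "a \<le> b" "(1 / 256) ^ Suc a \<le> R" "a = 0 \<or> R < (1 / 256) ^ a"
    "(1 / 256) ^ Suc b \<le> r" "b = 0 \<or> r < (1 / 256) ^ b"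
    "256 ^ (b - a) \<le> 256 * (R / r)" "R < 1 \<Longrightarrow> R / r \<le> 256 * 256 ^ (b - a)"
proof -
  have R: "0 < R" using assms by simp
  obtain a where a: "(1 / 256) ^ Suc a \<le> R" "a = 0 \<or> R < (1 / 256) ^ a" by (rule scale_exists[OF R])
  obtain b where b: "(1 / 256) ^ Suc b \<le> r" "b = 0 \<or> r < (1 / 256) ^ b" by (rule scale_exists[OF assms(1)])
  have ab: "a \<le> b"
  proof (rule ccontr)
    assume "\<not> a \<le> b"
    then have "R < (1 / 256) ^ a" "(1 / 256 :: real) ^ a \<le> (1 / 256) ^ Suc b"
      using a(2) by (auto intro!: power_decreasing simp del: power_Suc)
    then show False using b(1) assms(2) by linarith
  qed
  have quot: "(1 / 256 :: real) ^ a = 256 ^ (b - a) * (1 / 256) ^ b"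
    using ab by (simp add: power_diff power_one_over field_simps)
  have "256 ^ (b - a) \<le> 256 * (R / r)"
  proof (cases "b = 0")
    case True then show ?thesis using assms ab by (simp add: field_simps)
  next
    case False
    have "256 ^ (b - a) * r \<le> 256 ^ (b - a) * (1 / 256) ^ b"
      using b(2) False by (intro mult_left_mono) auto
    also have "\<dots> \<le> 256 * R" using a(1) unfolding quot[symmetric] by simp
    finally show ?thesis using assms(1) by (simp add: field_simps)
  qed
  moreover have "R / r \<le> 256 * 256 ^ (b - a)" if "R < 1"
  proof -
    have "R \<le> (1 / 256) ^ a" using a(2) that by auto
    also have "\<dots> = 256 * 256 ^ (b - a) * (1 / 256) ^ Suc b" unfolding quot by simp
    also have "\<dots> \<le> 256 * 256 ^ (b - a) * r" using b(1) by (intro mult_left_mono) auto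
    finally show ?thesis using assms(1) by (simp add: field_simps)
  qed
  ultimately show ?thesis using that ab a b by blast
qed

text \<open>These exponents turn the extreme growth rates 128 and 64 per level into the dimensions
  \<open>7 / 8\<close> and \<open>3 / 4\<close>.\<close>

lemma powr_256 [simp]: "(256::real) powr (7 / 8) = 128" "(256::real) powr (3 / 4) = 64"
proof -
  have "(256::real) = 2 powr 8" by (simp add: powr_numeral)
  then have "(256::real) powr (7 / 8) = 2 powr 7" "(256::real) powr (3 / 4) = 2 powr 6"
    by (simp_all add: powr_powr)
  then show "(256::real) powr (7 / 8) = 128" "(256::real) powr (3 / 4) = 64"
    by (simp_all add: powr_numeral)
qed

section \<open>Box, Assouad and lower dimension\<close>

abbreviation sponge_of :: "3 \<Rightarrow> (real ^ 3) set" where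
  "sponge_of j \<equiv> sponge grid (digits j)"

lemma bounded_sponge: "bounded (cball x R \<inter> sponge_of j)"
  by (simp add: bounded_Int)

lemma covering_number_pos:
  assumes "x \<in> sponge_of j" "0 \<le> R" "0 < r"
  shows "1 \<le> covering_number (cball x R \<inter> sponge_of j) r"
  using card_le_covering_number[of "{x}" "cball x R \<inter> sponge_of j" r] assms bounded_sponge by simp

lemma covering_number_ball_le:
  assumes "a = 0 \<or> R < (1 / 256) ^ a" "3 * (1 / 256) ^ b \<le> r"
  shows "covering_number (cball (point A) R \<inter> sponge_of j) r \<le> descendants j a b A"
proof (rule covering_number_cylinder_le[OF _ assms(2)])
  show "cball (point A) R \<inter> sponge_of j \<subseteq> point ` cylinder j a A"
    using assms(1) ball_subset_cylinder[of R a A j] cylinder_0[of j A] by (auto simp: sponge_digits)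
qed

lemma covering_number_ball_ge:
  assumes "3 * (1 / 256) ^ a \<le> R" "0 < r" "2 * r < (1 / 256) ^ b" "a \<le> b"
  shows "descendants j a b A \<le> covering_number (cball (point A) R \<inter> sponge_of j) r"
  by (rule covering_number_cylinder_ge[OF _ bounded_sponge assms(2,3,4)])
    (use cylinder_subset_ball[OF assms(1)] in \<open>simp add: sponge_digits\<close>)

lemma sponge_cases:
  assumes "x \<in> sponge_of j"
  obtains A where "x = point A" "A \<in> addresses j"
  using assms by (auto simp: sponge_digits)

text \<open>The constant collects two further levels at the small scale and one from comparing
  \<open>256 ^ (b - a)\<close> with \<open>R / r\<close>.\<close>

lemma covering_number_upper:
  assumes j: "j \<noteq> 2" and x: "x \<in> sponge_of j" and r: "0 < r" "r < R"
  shows "real (covering_number (cball x R \<inter> sponge_of j) r) \<le> 128 ^ 3 * (R / r) powr (7 / 8)"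
proof -
  obtain A where A: "x = point A" "A \<in> addresses j" using x by (rule sponge_cases)
  obtain a b where ab: "a \<le> b" "a = 0 \<or> R < (1 / 256) ^ a" "(1 / 256) ^ Suc b \<le> r"
      "256 ^ (b - a) \<le> 256 * (R / r)"
    using scale_pair[OF r] by metis
  have "covering_number (cball x R \<inter> sponge_of j) r \<le> descendants j a (b + 2) A"
    unfolding A(1) by (rule covering_number_ball_le[OF ab(2) three_scales[OF ab(3)]])
  also have "real (descendants j a (b + 2) A) \<le> 128 ^ (b + 2 - a)"
    by (rule descendants_le) (use ab j A in auto)
  also have "\<dots> = 128 ^ 2 * 128 ^ (b - a)" using ab(1) by (simp add: Suc_diff_le)
  also have "(128::real) ^ (b - a) = (256 ^ (b - a)) powr (7 / 8)" by (simp add: power_powr)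
  also have "\<dots> \<le> (256 * (R / r)) powr (7 / 8)" using ab(4) by (intro powr_mono2) auto
  also have "\<dots> = 128 * (R / r) powr (7 / 8)" using r by (subst powr_mult) auto
  finally show ?thesis by simp
qed

text \<open>The ball contains a cube two levels deeper, and separation gives up one level at the
  small scale. The fourth factor 64 comes from comparing \<open>R / r\<close> with
  \<open>256 ^ (b - a)\<close>.\<close>

lemma covering_number_lower:
  assumes j: "j \<noteq> 2" and x: "x \<in> sponge_of j" and r: "0 < r" "r < R" "R < 1"
  shows "(1 / 64) ^ 4 * (R / r) powr (3 / 4) \<le> real (covering_number (cball x R \<inter> sponge_of j) r)"
proof -
  obtain A where A: "x = point A" "A \<in> addresses j" using x by (rule sponge_cases)
  obtain a b where ab: "a \<le> b" "(1 / 256) ^ Suc a \<le> R" "b = 0 \<or> r < (1 / 256) ^ b"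
      "R / r \<le> 256 * 256 ^ (b - a)"
    using scale_pair[OF r(1,2)] r(3) by metis
  have N: "64 ^ (b - a - 3) \<le> real (covering_number (cball x R \<inter> sponge_of j) r)"
  proof (cases "a + 3 \<le> b")
    case True
    then obtain c where c: "b = Suc c" "a + 2 \<le> c" by (cases b) auto
    have "64 ^ (c - (a + 2)) \<le> (64::real) ^ (c - (a + 2)) * (3 / 2) ^ (c - depth j * (a + 2))"
      by simp
    also have "\<dots> \<le> real (descendants j (a + 2) c A)"
      by (rule descendants_ge) (use c j A in auto)
    also have "descendants j (a + 2) c A \<le> covering_number (cball x R \<inter> sponge_of j) r"
      unfolding A(1)
    proof (rule covering_number_ball_ge[OF _ r(1) _ c(2)])
      show "3 * (1 / 256) ^ (a + 2) \<le> R" by (rule three_scales[OF ab(2)])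
      show "2 * r < (1 / 256) ^ c" using ab(3) c(1) r(1) by simp
    qed
    finally show ?thesis using c(1) by (simp add: algebra_simps)
  next
    case False
    \<comment> \<open>The truncated exponent is 0 here, so one covering ball is enough.\<close>
    then show ?thesis using covering_number_pos[OF x _ r(1), of R] r by simp
  qed
  have "(R / r) powr (3 / 4) \<le> (256 * 256 ^ (b - a)) powr (3 / 4)"
    using ab(4) r by (intro powr_mono2) auto
  also have "\<dots> = 64 * 64 ^ (b - a)" by (simp add: powr_mult power_powr)
  also have "\<dots> \<le> 64 * 64 ^ (3 + (b - a - 3))" by (intro mult_left_mono power_increasing) auto
  also have "\<dots> = 64 ^ 4 * 64 ^ (b - a - 3)" by (simp add: power_add)
  also have "\<dots> \<le> 64 ^ 4 * real (covering_number (cball x R \<inter> sponge_of j) r)"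
    using N by (intro mult_left_mono) auto
  finally show ?thesis by (simp add: power_one_over field_simps)
qed

lemma UNIV_point: "point (\<lambda>_. UNIV) \<in> sponge_of j"
  and empty_point: "point (\<lambda>_. {}) \<in> sponge_of j"
  unfolding sponge_digits using UNIV_address empty_address by blast+

lemma assouad_dimension_sponge:
  assumes j: "j \<noteq> 2"
  shows "assouad_dimension (sponge_of j) = 7 / 8"
  unfolding assouad_dimension_def
proof (rule cInf_eq_minimum)
  show "7 / 8 \<in> {s. s > 0 \<and> (\<exists>C>0. \<forall>x\<in>sponge_of j. \<forall>r R. 0 < r \<and> r < R \<longrightarrow>
      real (covering_number (cball x R \<inter> sponge_of j) r) \<le> C * (R / r) powr s)}"
    using covering_number_upper[OF j] by (auto intro!: exI[of _ "128 ^ 3"])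
  fix s :: real
  assume "s \<in> {s. s > 0 \<and> (\<exists>C>0. \<forall>x\<in>sponge_of j. \<forall>r R. 0 < r \<and> r < R \<longrightarrow>
      real (covering_number (cball x R \<inter> sponge_of j) r) \<le> C * (R / r) powr s)}"
  then obtain C where C: "\<And>x r R. x \<in> sponge_of j \<Longrightarrow> 0 < r \<Longrightarrow> r < R \<Longrightarrow>
      real (covering_number (cball x R \<inter> sponge_of j) r) \<le> C * (R / r) powr s" by blast
  have "128 ^ a \<le> C * (3 * 256) powr s * (256 powr s) ^ a" for a :: nat
  proof -
    let ?A = "\<lambda>_. UNIV :: nat set"
    \<comment> \<open>The ball of radius \<open>?R\<close> contains the cylinder of level
      \<open>a\<close>, and \<open>?r\<close> lies just below the separation at level
      \<open>2 * a\<close>, up to which the all-2 address attains the rate 128.\<close>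
    let ?R = "3 * (1 / 256) ^ a :: real" and ?r = "(1 / 256) ^ Suc (2 * a) :: real"
    have q: "(1 / 256 :: real) ^ (2 * a) = (1 / 256) ^ a * (1 / 256) ^ a" by (simp add: mult_2 power_add)
    have "(1 / 256 :: real) ^ Suc (2 * a) \<le> (1 / 256) ^ a" by (rule power_decreasing) auto
    also have "\<dots> < ?R" by simp
    finally have rR: "?r < ?R" .
    have "128 ^ a = real (descendants j a (2 * a) ?A)"
      using descendants_UNIV[of a "2 * a" j] depth_ge_2[OF j] j by simp
    also have "\<dots> \<le> real (covering_number (cball (point ?A) ?R \<inter> sponge_of j) ?r)"
      unfolding of_nat_le_iff by (rule covering_number_ball_ge) auto
    also have "\<dots> \<le> C * (?R / ?r) powr s" by (rule C[OF UNIV_point _ rR]) simp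
    also have "?R / ?r = 3 * 256 * 256 ^ a"
      unfolding power_Suc q by (simp add: power_one_over)
    also have "(3 * 256 * 256 ^ a) powr s = (3 * 256) powr s * (256 powr s) ^ a"
      by (simp only: powr_mult power_powr zero_less_numeral)
    finally show ?thesis by (simp add: mult.assoc)
  qed
  then have "128 \<le> 256 powr s" by (rule le_if_power_le_const_mult) simp
  then have "256 powr (7 / 8) \<le> 256 powr s" by simp
  then show "7 / 8 \<le> s" by (simp only: powr_le_cancel_iff)
qed

lemma lower_dimension_sponge:
  assumes j: "j \<noteq> 2"
  shows "lower_dimension (sponge_of j) = 3 / 4"
  unfolding lower_dimension_def
proof (rule cSup_eq_maximum)
  let ?S = "insert 0 {s. s > 0 \<and> (\<exists>C>0. \<forall>x\<in>sponge_of j. \<forall>r R. 0 < r \<and> r < R \<and> R < 1 \<longrightarrow>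
      real (covering_number (cball x R \<inter> sponge_of j) r) \<ge> C * (R / r) powr s)}"
  show "3 / 4 \<in> ?S"
    using covering_number_lower[OF j] by (auto intro!: exI[of _ "(1 / 64) ^ 4"])
  fix s :: real
  assume "s \<in> ?S"
  then consider "s = 0" | C where "0 < C" "\<And>x r R. x \<in> sponge_of j \<Longrightarrow> 0 < r \<Longrightarrow> r < R \<Longrightarrow> R < 1 \<Longrightarrow>
      C * (R / r) powr s \<le> real (covering_number (cball x R \<inter> sponge_of j) r)" by blast
  then show "s \<le> 3 / 4"
  proof cases
    case 2
    have "(256 powr s) ^ k \<le> 64 ^ 2 / (C * (256 / 3) powr s) * 64 ^ k" for k :: nat
    proof -
      \<comment> \<open>The shift by 2 makes \<open>?r < ?R\<close> hold for every
        \<open>k\<close>.\<close>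
      define a where "a = k + 2"
      let ?A = "\<lambda>_. {} :: nat set"
      let ?R = "(1 / 256) ^ Suc a :: real" and ?r = "3 * (1 / 256) ^ (2 * a) :: real"
      have quot: "?R / ?r = 256 / 3 * 256 ^ k"
        by (simp add: a_def mult_2 power_add power_one_over)
      have "(1::real) \<le> 256 ^ k" by simp
      then have "1 < ?R / ?r" unfolding quot by linarith
      then have rR: "?r < ?R" by (simp add: field_simps)
      have R1: "?R < 1" by (rule power_Suc_less_one) auto
      have "C * ((256 / 3) powr s * (256 powr s) ^ k) = C * (?R / ?r) powr s"
        unfolding quot by (simp only: powr_mult power_powr zero_less_numeral)
      also have "\<dots> \<le> real (covering_number (cball (point ?A) ?R \<inter> sponge_of j) ?r)"
        by (rule 2(2)[OF empty_point _ rR R1]) simp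
      also have "\<dots> \<le> real (descendants j a (2 * a) ?A)"
        unfolding of_nat_le_iff by (rule covering_number_ball_le) auto
      also have "\<dots> = 64 ^ a"
        using descendants_empty[of a "2 * a" j] depth_ge_2[OF j] j by simp
      finally show ?thesis using 2(1) by (simp add: a_def field_simps power_add)
    qed
    then have "256 powr s \<le> 64" by (rule le_if_power_le_const_mult) simp
    then have "256 powr s \<le> 256 powr (3 / 4)" by simp
    then show ?thesis by (simp only: powr_le_cancel_iff)
  qed simp
qed

section \<open>Box dimension\<close>

lemma tendsto_inverse_ln: "((\<lambda>r. c / ln (1 / r)) \<longlongrightarrow> 0) (at_right (0::real))"
proof -
  have "filterlim (\<lambda>r::real. ln (inverse r)) at_top (at_right 0)"
    by (rule filterlim_compose[OF ln_at_top filterlim_inverse_at_top_right])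
  then have "filterlim (\<lambda>r::real. ln (1 / r)) at_infinity (at_right 0)"
    by (simp add: inverse_eq_divide filterlim_at_top_imp_at_infinity)
  then show ?thesis by (rule tendsto_divide_0[OF tendsto_const])
qed

text \<open>The count at level \<open>a\<close> is exactly \<open>96 ^ a\<close>. Passing between
  \<open>r\<close> and its level costs at most two levels, an additive error that vanishes after
  division by \<open>ln (1 / r)\<close>.\<close>

lemma has_box_dimension_sponge:
  assumes j: "j \<noteq> 2"
  shows "has_box_dimension (sponge_of j) (ln 96 / ln 256)"
  unfolding has_box_dimension_def
proof (rule tendsto_sandwich)
  let ?A = "\<lambda>_. {} :: nat set"
  let ?f = "\<lambda>r. ln (real (covering_number (sponge_of j) r)) / ln (1 / r)"
  have bounds: "ln 96 / ln 256 - 2 * ln 96 / ln (1 / r) \<le> ?f r \<and> ?f r \<le> ln 96 / ln 256 + 2 * ln 96 / ln (1 / r)"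
    if r: "0 < r" "r < 1 / 256" for r
  proof -
    obtain a where a: "(1 / 256) ^ Suc a \<le> r" "a = 0 \<or> r < (1 / 256) ^ a"
      by (rule scale_exists[OF r(1)])
    \<comment> \<open>A positive level provides both the bound \<open>r < (1 / 256) ^ a\<close> and
      the preceding level \<open>b\<close>.\<close>
    have "a \<noteq> 0" using a(1) r(2) by (cases a) auto
    then obtain b where b: "a = Suc b" using not0_implies_Suc by blast
    have ra: "r < (1 / 256) ^ a" using a(2) \<open>a \<noteq> 0\<close> by blast
    have cyl: "sponge_of j = point ` cylinder j 0 ?A" by (simp add: cylinder_0 sponge_digits)
    have "covering_number (sponge_of j) r \<le> descendants j 0 (a + 2) ?A"
      by (rule covering_number_cylinder_le[OF _ three_scales[OF a(1)]]) (use cyl in auto)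
    also have "real (descendants j 0 (a + 2) ?A) = 96 ^ (a + 2)"
      by (rule descendants_0[OF j empty_address])
    finally have up: "real (covering_number (sponge_of j) r) \<le> 96 ^ (a + 2)" by simp
    have "96 ^ b = real (descendants j 0 b ?A)" by (rule descendants_0[OF j empty_address, symmetric])
    also have "descendants j 0 b ?A \<le> covering_number (sponge_of j) r"
      by (rule covering_number_cylinder_ge)
        (use cyl ra b r(1) bounded_points[of "cylinder j 0 ?A"] in auto)
    finally have lo: "96 ^ b \<le> real (covering_number (sponge_of j) r)" by simp
    have pos: "0 < real (covering_number (sponge_of j) r)"
      using lo by (rule less_le_trans[rotated]) simp
    have "ln (real (covering_number (sponge_of j) r)) \<le> ln (96 ^ (a + 2))"
      using up pos by (subst ln_le_cancel_iff) auto
    then have up': "ln (real (covering_number (sponge_of j) r)) \<le> real (a + 2) * ln 96"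
      by (simp only: ln_realpow)
    have "ln (96 ^ b) \<le> ln (real (covering_number (sponge_of j) r))"
      using lo pos by (subst ln_le_cancel_iff) auto
    then have lo': "real b * ln 96 \<le> ln (real (covering_number (sponge_of j) r))"
      by (simp only: ln_realpow)
    have "256 ^ a \<le> 1 / r" using ra r(1) by (simp add: power_one_over field_simps)
    then have "ln (256 ^ a) \<le> ln (1 / r)" using r by (subst ln_le_cancel_iff) auto
    then have t1: "real a * ln 256 \<le> ln (1 / r)" by (simp only: ln_realpow)
    have "1 / r \<le> 256 ^ Suc a" using a(1) r(1) by (simp add: power_one_over field_simps)
    then have "ln (1 / r) \<le> ln (256 ^ Suc a)" using r by (subst ln_le_cancel_iff) auto
    then have t2: "ln (1 / r) \<le> real (Suc a) * ln 256" by (simp only: ln_realpow)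
    \<comment> \<open>The real-valued level of \<open>r\<close>, that is
      \<open>r = 256^-t\<close>.\<close>
    define t where "t = ln (1 / r) / ln 256"
    have l: "0 < ln (1 / r)" using r by simp
    have t: "real a \<le> t" "t \<le> real (Suc a)" using t1 t2 by (simp_all add: t_def field_simps)
    have "real (a + 2) * ln 96 \<le> (t + 2) * ln 96" by (rule mult_right_mono) (use t in auto)
    then have "ln (real (covering_number (sponge_of j) r)) / ln (1 / r) \<le> (t + 2) * ln 96 / ln (1 / r)"
      using up' l by (intro divide_right_mono order_trans[OF up']) auto
    moreover have "(t - 2) * ln 96 \<le> real b * ln 96" by (rule mult_right_mono) (use t b in auto)
    then have "(t - 2) * ln 96 / ln (1 / r) \<le> ln (real (covering_number (sponge_of j) r)) / ln (1 / r)"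
      using lo' l by (intro divide_right_mono order_trans[OF _ lo']) auto
    moreover have "t * ln 96 / ln (1 / r) = ln 96 / ln 256" using l by (simp add: t_def)
    ultimately show ?thesis by (simp add: ring_distribs add_divide_distrib diff_divide_distrib)
  qed
  have "\<forall>\<^sub>F r in at_right (0::real). 0 < r \<and> r < 1 / 256"
    by (auto simp: eventually_at_right[of 0 "1 / 256"] intro!: exI[of _ "1 / 256"])
  then show "\<forall>\<^sub>F r in at_right 0. ln 96 / ln 256 - 2 * ln 96 / ln (1 / r) \<le> ?f r"
    and "\<forall>\<^sub>F r in at_right 0. ?f r \<le> ln 96 / ln 256 + 2 * ln 96 / ln (1 / r)"
    by (eventually_elim, use bounds in blast)+
  show "((\<lambda>r. ln 96 / ln 256 - 2 * ln 96 / ln (1 / r)) \<longlongrightarrow> ln 96 / ln 256) (at_right (0::real))"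
    using tendsto_diff[OF tendsto_const tendsto_inverse_ln] by simp
  show "((\<lambda>r. ln 96 / ln 256 + 2 * ln 96 / ln (1 / r)) \<longlongrightarrow> ln 96 / ln 256) (at_right (0::real))"
    using tendsto_add[OF tendsto_const tendsto_inverse_ln] by simp
qed

lemma box_dimension_eqI:
  assumes "has_box_dimension F s"
  shows "box_dimension F = s"
  unfolding box_dimension_def
proof (rule the_equality[where P = "has_box_dimension F", OF assms])
  fix t assume "has_box_dimension F t"
  then show "t = s" using assms unfolding has_box_dimension_def
    by (intro tendsto_unique[OF trivial_limit_at_right_real])
qed

section \<open>The spectra at 1/3\<close>

lemma powr_3 [simp]: "0 < R \<Longrightarrow> R powr (1 / (1 / 3)) = R ^ 3" for R :: real
  by (simp add: powr_numeral)

lemma cube_ratio: "0 < R \<Longrightarrow> R / R ^ 3 = (1 / R) ^ 2" for R :: real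
  by (simp add: power_one_over field_simps power3_eq_cube power2_eq_square)

lemma power3_less: "0 < R \<Longrightarrow> R < 1 \<Longrightarrow> R ^ 3 < R" for R :: real
  using power_strict_decreasing[of 1 3 R] by simp

lemma cube_scale: "((1 / 256) ^ Suc a) ^ 3 = (1 / 256 :: real) ^ Suc (3 * a + 2)"
proof -
  have "Suc a * 3 = Suc (3 * a + 2)" by simp
  then show ?thesis by (metis power_mult)
qed

text \<open>The factor \<open>1 / 256\<close> is split off to absorb the constants 2 and
  \<open>3 ^ 3\<close> that occur when radii are compared with separations.\<close>

lemma cube_scale_pred:
  assumes "0 < a"
  shows "((1 / 256) ^ a) ^ 3 = 1 / 256 * (1 / 256 :: real) ^ (3 * a - 1)"
proof -
  have "a * 3 = Suc (3 * a - 1)" using assms by simp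
  then show ?thesis by (metis power_mult power_Suc)
qed

definition upper_exponents :: "(real ^ 3) set \<Rightarrow> real set" where
  "upper_exponents F = {s. s > 0 \<and> (\<exists>C>0. \<forall>R x. 0 < R \<and> R < 1 \<and> x \<in> F \<longrightarrow>
     real (covering_number (cball x R \<inter> F) (R ^ 3)) \<le> C * ((1 / R) ^ 2) powr s)}"

definition lower_exponents :: "(real ^ 3) set \<Rightarrow> real set" where
  "lower_exponents F = {s. s > 0 \<and> (\<exists>C>0. \<forall>R x. 0 < R \<and> R < 1 \<and> x \<in> F \<longrightarrow>
     real (covering_number (cball x R \<inter> F) (R ^ 3)) \<ge> C * ((1 / R) ^ 2) powr s)}"

lemma assouad_spectrum_third: "assouad_spectrum F (1 / 3) = Inf (upper_exponents F)"
proof -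
  have "(0 < R \<and> R < 1 \<and> x \<in> F \<longrightarrow>
        real (covering_number (cball x R \<inter> F) (R powr (1 / (1 / 3))))
          \<le> C * (R / R powr (1 / (1 / 3))) powr s) \<longleftrightarrow>
      (0 < R \<and> R < 1 \<and> x \<in> F \<longrightarrow>
     real (covering_number (cball x R \<inter> F) (R ^ 3)) \<le> C * ((1 / R) ^ 2) powr s)" for R C s :: real and x
    by (cases "0 < R") (simp_all only: powr_3 cube_ratio simp_thms)
  then show ?thesis unfolding assouad_spectrum_def upper_exponents_def by (simp only:)
qed

lemma lower_spectrum_third: "lower_spectrum F (1 / 3) = Sup (insert 0 (lower_exponents F))"
proof -
  have "(0 < R \<and> R < 1 \<and> x \<in> F \<longrightarrow>
        real (covering_number (cball x R \<inter> F) (R powr (1 / (1 / 3))))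
          \<ge> C * (R / R powr (1 / (1 / 3))) powr s) \<longleftrightarrow>
      (0 < R \<and> R < 1 \<and> x \<in> F \<longrightarrow>
     real (covering_number (cball x R \<inter> F) (R ^ 3)) \<ge> C * ((1 / R) ^ 2) powr s)" for R C s :: real and x
    by (cases "0 < R") (simp_all only: powr_3 cube_ratio simp_thms)
  then show ?thesis unfolding lower_spectrum_def lower_exponents_def by (simp only:)
qed

lemma powr_256_sq: "((256::real) ^ (2 * a)) powr s = (65536 powr s) ^ a"
proof -
  have "(256::real) ^ (2 * a) = 65536 ^ a" by (simp add: power_mult)
  then show ?thesis by (simp add: power_powr)
qed

text \<open>One level of \<open>R\<close> changes \<open>R / R ^ 3\<close> by
  \<open>256 ^ 2 = 65536\<close>, so the extreme growth rates become \<open>128 ^ 2\<close> and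
  \<open>64 ^ 2\<close>.\<close>

lemma powr_65536 [simp]: "(65536::real) powr (7 / 8) = 16384" "(65536::real) powr (3 / 4) = 4096"
proof -
  have e: "(65536::real) = 256 * 256" by simp
  show "(65536::real) powr (7 / 8) = 16384" "(65536::real) powr (3 / 4) = 4096"
    unfolding e by (simp_all only: powr_mult powr_256)
qed

text \<open>Depth 4 keeps all controlling letters fixed up to level \<open>4 * a\<close>, beyond the
  level \<open>3 * a - 1\<close> used here, so the maximal rate persists.\<close>

lemma covering_number_0_UNIV:
  assumes "1 \<le> a"
  shows "128 ^ (2 * a - 1) \<le>
    real (covering_number (cball (point (\<lambda>_. UNIV)) (3 * (1 / 256) ^ a) \<inter> sponge_of 0) ((3 * (1 / 256) ^ a) ^ 3))"
proof -
  obtain c where c: "a = Suc c" using assms by (cases a) auto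
  let ?b = "3 * a - 1"
  have "128 ^ (2 * a - 1) = real (descendants 0 a ?b (\<lambda>_. UNIV))"
    using descendants_UNIV[of a ?b 0] c by (simp add: depth_def)
  also have "\<dots> \<le> real (covering_number (cball (point (\<lambda>_. UNIV)) (3 * (1 / 256) ^ a) \<inter> sponge_of 0)
      ((3 * (1 / 256) ^ a) ^ 3))"
    unfolding of_nat_le_iff
  proof (rule covering_number_ball_ge)
    have "(3 * (1 / 256 :: real) ^ a) ^ 3 = 27 * (1 / 256) * (1 / 256) ^ ?b"
      using c by (simp add: power_mult_distrib[of 3] cube_scale_pred del: power_Suc)
    moreover have "0 < (1 / 256 :: real) ^ ?b" by simp
    ultimately show "2 * (3 * (1 / 256 :: real) ^ a) ^ 3 < (1 / 256) ^ ?b" by linarith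
  qed (use c in auto)
  finally show ?thesis .
qed

text \<open>The cover uses level \<open>3 * a + 4\<close>, and \<open>4 \<le> a\<close> keeps this
  within the \<open>4 * a\<close> fixed controlling letters, all of them 0.\<close>

lemma covering_number_0_empty:
  assumes "4 \<le> a"
  shows "real (covering_number (cball (point (\<lambda>_. {})) ((1 / 256) ^ Suc a) \<inter> sponge_of 0) (((1 / 256) ^ Suc a) ^ 3))
    \<le> 64 ^ (2 * a + 4)"
proof -
  have "covering_number (cball (point (\<lambda>_. {})) ((1 / 256) ^ Suc a) \<inter> sponge_of 0) (((1 / 256) ^ Suc a) ^ 3)
      \<le> descendants 0 a (3 * a + 4) (\<lambda>_. {})"
  proof (rule covering_number_ball_le)
    show "3 * (1 / 256) ^ (3 * a + 4) \<le> ((1 / 256 :: real) ^ Suc a) ^ 3"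
      using three_scales[of "3 * a + 2", OF order_refl] unfolding cube_scale
      by (simp add: power_add power_divide)
  qed auto
  also have "real (descendants 0 a (3 * a + 4) (\<lambda>_. {})) = 64 ^ (2 * a + 4)"
    using descendants_empty[of a "3 * a + 4" 0] assms by (simp add: depth_def)
  finally show ?thesis by simp
qed

text \<open>The rate \<open>12288 = 64 ^ 2 * 2 * (3 / 2)\<close> combines one letter controlled by a
  fixed 2 with one averaged letter.\<close>

lemma power_product_eq:
  "64 ^ (2 * a + m) * 2 ^ a * (3 / 2) ^ (a + m) = 64 ^ m * (3 / 2) ^ m * (12288 :: real) ^ a"
proof -
  have "(12288 :: real) ^ a = 64 ^ (2 * a) * 2 ^ a * (3 / 2) ^ a"
    by (simp add: power_mult flip: power_mult_distrib)
  then show ?thesis by (simp only: power_add mult_ac)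
qed

lemma covering_number_1_le:
  assumes x: "x \<in> sponge_of 1" and R: "0 < R" "R < 1"
  shows "real (covering_number (cball x R \<inter> sponge_of 1) (R ^ 3)) \<le>
    64 ^ 4 * (3 / 2) ^ 4 * ((1 / R) ^ 2) powr (log 65536 12288)"
proof -
  obtain A where A: "x = point A" "A \<in> addresses 1" using x by (rule sponge_cases)
  obtain a where a: "(1 / 256) ^ Suc a \<le> R" "a = 0 \<or> R < (1 / 256) ^ a" by (rule scale_exists[OF R(1)])
  have "((1 / 256) ^ Suc a) ^ 3 \<le> R ^ 3" using a(1) by (rule power_mono) simp
  then have r: "3 * (1 / 256) ^ (3 * a + 4) \<le> R ^ 3"
    unfolding cube_scale using three_scales[of "3 * a + 2" "R ^ 3"] by (simp add: power_add power_divide)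
  have "covering_number (cball x R \<inter> sponge_of 1) (R ^ 3) \<le> descendants 1 a (3 * a + 4) A"
    unfolding A(1) by (rule covering_number_ball_le[OF a(2) r])
  also have "real (descendants 1 a (3 * a + 4) A) \<le> 64 ^ (3 * a + 4 - a) * 2 ^ a * (3 / 2) ^ (3 * a + 4 - 2 * a)"
    by (rule descendants_1_le) (use A in auto)
  also have "3 * a + 4 - a = 2 * a + 4" by simp
  also have "3 * a + 4 - 2 * a = a + 4" by simp
  also have "64 ^ (2 * a + 4) * 2 ^ a * (3 / 2) ^ (a + 4) = 64 ^ 4 * (3 / 2 :: real) ^ 4 * 12288 ^ a"
    by (rule power_product_eq)
  also have "(12288 :: real) ^ a = (256 ^ (2 * a)) powr (log 65536 12288)"
    unfolding powr_256_sq by simp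
  also have "\<dots> \<le> ((1 / R) ^ 2) powr (log 65536 12288)"
  proof (intro powr_mono2)
    have "R \<le> (1 / 256) ^ a" using a(2) R(2) by auto
    then have "256 ^ a \<le> 1 / R" using R(1) by (simp add: power_one_over field_simps)
    then have "(256 ^ a) ^ 2 \<le> (1 / R) ^ 2" by (intro power_mono) auto
    then show "256 ^ (2 * a) \<le> (1 / R) ^ 2" by (simp add: power_mult[symmetric] mult.commute)
  qed auto
  finally show ?thesis by simp
qed

text \<open>Between levels \<open>2 * a\<close> and \<open>3 * a\<close> the third coordinate is
  averaged in every ball, which raises the minimal rate 4096 to
  \<open>6144 = 64 ^ 2 * (3 / 2)\<close>.\<close>

lemma covering_number_1_ge:
  assumes x: "x \<in> sponge_of 1" and R: "0 < R" "R < 1"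
  shows "((1 / R) ^ 2) powr (log 65536 6144) / (6144 * 64 ^ 3 * (3 / 2) ^ 5) \<le>
    real (covering_number (cball x R \<inter> sponge_of 1) (R ^ 3))"
proof -
  let ?N = "real (covering_number (cball x R \<inter> sponge_of 1) (R ^ 3))"
  obtain A where A: "x = point A" "A \<in> addresses 1" using x by (rule sponge_cases)
  obtain a where a: "(1 / 256) ^ Suc a \<le> R" "a = 0 \<or> R < (1 / 256) ^ a" by (rule scale_exists[OF R(1)])
  \<comment> \<open>The losses come from starting at level \<open>a + 2\<close> and stopping at
    \<open>3 * a - 1\<close>; both differences are truncated at 0.\<close>
  have N: "64 ^ (2 * a - 3) * (3 / 2) ^ (a - 5) \<le> ?N"
  proof (cases "2 \<le> a")
    case True
    define c where "c = a - 2"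
    have c: "a = Suc (Suc c)" using True by (simp add: c_def)
    let ?b = "3 * a - 1"
    have "64 ^ (?b - (a + 2)) * (3 / 2) ^ (?b - depth 1 * (a + 2)) \<le> real (descendants 1 (a + 2) ?b A)"
      by (rule descendants_ge) (use A True in auto)
    also have "?b - (a + 2) = 2 * a - 3" by simp
    also have "?b - depth 1 * (a + 2) = a - 5" by (simp add: depth_def)
    also have "descendants 1 (a + 2) ?b A \<le> covering_number (cball x R \<inter> sponge_of 1) (R ^ 3)"
      unfolding A(1)
    proof (rule covering_number_ball_ge[OF three_scales[OF a(1)]])
      have "R ^ 3 \<le> ((1 / 256) ^ a) ^ 3" using a(2) R c by (intro power_mono) auto
      also have "\<dots> = 1 / 256 * (1 / 256) ^ ?b"
        using c by (intro cube_scale_pred) simp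
      finally have "2 * R ^ 3 \<le> 1 / 128 * (1 / 256) ^ ?b" by simp
      also have "\<dots> < (1 / 256) ^ ?b" by simp
      finally show "2 * R ^ 3 < (1 / 256) ^ ?b" .
    qed (use R True in auto)
    finally show ?thesis by simp
  next
    case False
    then show ?thesis using covering_number_pos[OF x, of R "R ^ 3"] R by simp
  qed
  have "((1 / R) ^ 2) powr (log 65536 6144) \<le> (256 ^ (2 * Suc a)) powr (log 65536 6144)"
  proof (intro powr_mono2)
    have "1 / R \<le> 256 ^ Suc a" using a(1) R(1) by (simp add: power_one_over field_simps)
    then have "(1 / R) ^ 2 \<le> (256 ^ Suc a) ^ 2" using R by (intro power_mono) auto
    then show "(1 / R) ^ 2 \<le> 256 ^ (2 * Suc a)" by (simp only: power_mult[symmetric] mult.commute)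
  qed auto
  also have "\<dots> = 6144 * (64 ^ (2 * a) * (3 / 2) ^ a)"
    unfolding powr_256_sq by (simp add: power_mult power_mult_distrib[symmetric])
  also have "\<dots> \<le> 6144 * (64 ^ (3 + (2 * a - 3)) * (3 / 2) ^ (5 + (a - 5)))"
    by (intro mult_left_mono mult_mono power_increasing) auto
  also have "\<dots> = 6144 * 64 ^ 3 * (3 / 2) ^ 5 * (64 ^ (2 * a - 3) * (3 / 2) ^ (a - 5))"
    by (simp only: power_add mult_ac)
  also have "\<dots> \<le> 6144 * 64 ^ 3 * (3 / 2) ^ 5 * ?N" by (rule mult_left_mono[OF N]) simp
  finally show ?thesis by (simp add: field_simps)
qed

lemma upper_exponents_bound:
  assumes j: "j \<noteq> 2"
  shows "7 / 8 \<in> upper_exponents (sponge_of j)"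
proof -
  have "real (covering_number (cball x R \<inter> sponge_of j) (R ^ 3)) \<le> 128 ^ 3 * ((1 / R) ^ 2) powr (7 / 8)"
    if "0 < R \<and> R < 1 \<and> x \<in> sponge_of j" for R x
    using covering_number_upper[OF j, of x "R ^ 3" R] that
    by (simp add: power3_less cube_ratio)
  then show ?thesis unfolding upper_exponents_def by (auto intro!: exI[of _ "128 ^ 3"])
qed

lemma assouad_spectrum_0_ge: "7 / 8 \<le> assouad_spectrum (sponge_of 0) (1 / 3)"
  unfolding assouad_spectrum_third
proof (rule cInf_greatest)
  show "upper_exponents (sponge_of 0) \<noteq> {}" using upper_exponents_bound[of 0] by auto
  fix s assume "s \<in> upper_exponents (sponge_of 0)"
  then obtain C where C: "0 < C" "\<And>x R. x \<in> sponge_of 0 \<Longrightarrow> 0 < R \<Longrightarrow> R < 1 \<Longrightarrow>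
      real (covering_number (cball x R \<inter> sponge_of 0) (R ^ 3)) \<le> C * ((1 / R) ^ 2) powr s" and s: "0 < s"
    unfolding upper_exponents_def by blast
  have "16384 ^ k \<le> C * 65536 powr s * (65536 powr s) ^ k" for k :: nat
  proof -
    \<comment> \<open>\<open>Suc k\<close> ensures \<open>?R < 1\<close> even for
      \<open>k = 0\<close>.\<close>
    let ?R = "3 * (1 / 256) ^ Suc k :: real"
    have le1: "(1 / 256 :: real) ^ k \<le> 1" by (rule power_le_one) auto
    have R: "0 < ?R" "?R < 1" using le1 by simp_all
    have "(16384 :: real) ^ k = 128 ^ (2 * k)" by (simp add: power_mult)
    also have "\<dots> \<le> 128 ^ (2 * Suc k - 1)" by (rule power_increasing) auto
    also have "\<dots> \<le> real (covering_number (cball (point (\<lambda>_. UNIV)) ?R \<inter> sponge_of 0) (?R ^ 3))"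
      by (rule covering_number_0_UNIV) simp
    also have "\<dots> \<le> C * ((1 / ?R) ^ 2) powr s" by (rule C(2)[OF UNIV_point R])
    also have "\<dots> \<le> C * (256 ^ (2 * Suc k)) powr s"
    proof (intro mult_left_mono powr_mono2)
      have "1 / ?R \<le> 256 ^ Suc k" by (simp add: power_one_over field_simps)
      then have "(1 / ?R) ^ 2 \<le> (256 ^ Suc k) ^ 2" using R by (intro power_mono) auto
      then show "(1 / ?R) ^ 2 \<le> 256 ^ (2 * Suc k)" by (simp only: power_mult[symmetric] mult.commute)
    qed (use C s in auto)
    finally show ?thesis unfolding powr_256_sq by simp
  qed
  then have "16384 \<le> 65536 powr s" by (rule le_if_power_le_const_mult) simp
  then have "65536 powr (7 / 8) \<le> 65536 powr s" by simp
  then show "7 / 8 \<le> s" by (simp only: powr_le_cancel_iff)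
qed

text \<open>The rate 12288 is strictly below \<open>16384 = 128 ^ 2\<close>, the rate of exponent
  \<open>7 / 8\<close>.\<close>

lemma assouad_spectrum_1_less: "assouad_spectrum (sponge_of 1) (1 / 3) < 7 / 8"
proof -
  have "log 65536 12288 \<in> upper_exponents (sponge_of 1)"
    unfolding upper_exponents_def using covering_number_1_le
    by (auto intro!: exI[of _ "64 ^ 4 * (3 / 2) ^ 4"])
  moreover have "bdd_below (upper_exponents (sponge_of 1))"
    by (rule bdd_belowI[of _ 0]) (auto simp: upper_exponents_def)
  ultimately have "Inf (upper_exponents (sponge_of 1)) \<le> log 65536 12288" by (rule cInf_lower)
  also have "\<dots> < log 65536 16384" by simp
  also have "\<dots> = 7 / 8" using log_powr_cancel[of 65536 "7 / 8"] by simp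
  finally show ?thesis unfolding assouad_spectrum_third .
qed

lemma lower_spectrum_0_le: "lower_spectrum (sponge_of 0) (1 / 3) \<le> 3 / 4"
  unfolding lower_spectrum_third
proof (rule cSup_least)
  fix s assume "s \<in> insert 0 (lower_exponents (sponge_of 0))"
  then consider "s = 0" | C where "0 < C" "0 < s" "\<And>x R. x \<in> sponge_of 0 \<Longrightarrow> 0 < R \<Longrightarrow> R < 1 \<Longrightarrow>
      C * ((1 / R) ^ 2) powr s \<le> real (covering_number (cball x R \<inter> sponge_of 0) (R ^ 3))"
    unfolding lower_exponents_def by blast
  then show "s \<le> 3 / 4"
  proof cases
    case 2
    have "(65536 powr s) ^ k \<le> 64 ^ 12 / (C * (65536 powr s) ^ 5) * 4096 ^ k" for k :: nat
    proof -
      \<comment> \<open>The shift meets the requirement \<open>4 \<le> a\<close> of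
        \<open>covering_number_0_empty\<close>.\<close>
      define a where "a = k + 4"
      have Suc_a: "Suc a = k + 5" by (simp add: a_def)
      let ?R = "(1 / 256) ^ Suc a :: real"
      have R: "0 < ?R" "?R < 1" by (simp, rule power_Suc_less_one) auto
      have "(1 / ?R) ^ 2 = 256 ^ (2 * Suc a)"
        by (simp only: power_one_over power_mult[symmetric] mult.commute) (simp add: power_one_over)
      then have "C * (65536 powr s) ^ Suc a = C * ((1 / ?R) ^ 2) powr s" by (simp only: powr_256_sq)
      also have "\<dots> \<le> real (covering_number (cball (point (\<lambda>_. {})) ?R \<inter> sponge_of 0) (?R ^ 3))"
        by (rule 2(3)[OF empty_point R])
      also have "\<dots> \<le> 64 ^ (2 * a + 4)" by (rule covering_number_0_empty) (simp add: a_def)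
      also have "\<dots> = 64 ^ 12 * 4096 ^ k" by (simp add: a_def power_add power_mult)
      finally have "C * ((65536 powr s) ^ k * (65536 powr s) ^ 5) \<le> 64 ^ 12 * 4096 ^ k"
        unfolding Suc_a power_add .
      then show ?thesis using 2(1) by (simp add: field_simps)
    qed
    then have "65536 powr s \<le> 4096" by (rule le_if_power_le_const_mult) simp
    then have "65536 powr s \<le> 65536 powr (3 / 4)" by simp
    then show ?thesis by (simp only: powr_le_cancel_iff)
  qed simp
qed simp

text \<open>The general upper bound on covering numbers limits the lower exponents, so the supremum
  in the lower spectrum is taken over a bounded set.\<close>

lemma lower_exponents_le:
  assumes j: "j \<noteq> 2" and "s \<in> lower_exponents (sponge_of j)"
  shows "s \<le> 7 / 8"
proof -
  obtain C where C: "0 < C" "\<And>x R. x \<in> sponge_of j \<Longrightarrow> 0 < R \<Longrightarrow> R < 1 \<Longrightarrow>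
      C * ((1 / R) ^ 2) powr s \<le> real (covering_number (cball x R \<inter> sponge_of j) (R ^ 3))"
    using assms(2) unfolding lower_exponents_def by blast
  have "(65536 powr s) ^ k \<le> 128 ^ 3 * 16384 / (C * 65536 powr s) * 16384 ^ k" for k :: nat
  proof -
    let ?R = "(1 / 256) ^ Suc k :: real"
    have R: "0 < ?R" "?R < 1" by (simp, rule power_Suc_less_one) auto
    have q: "(1 / ?R) ^ 2 = 256 ^ (2 * Suc k)"
      by (simp only: power_one_over power_mult[symmetric] mult.commute) (simp add: power_one_over)
    have "C * (65536 powr s) ^ Suc k = C * ((1 / ?R) ^ 2) powr s" unfolding q by (simp only: powr_256_sq)
    also have "\<dots> \<le> real (covering_number (cball (point (\<lambda>_. UNIV)) ?R \<inter> sponge_of j) (?R ^ 3))"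
      by (rule C(2)[OF UNIV_point R])
    also have "\<dots> \<le> 128 ^ 3 * (?R / ?R ^ 3) powr (7 / 8)"
      by (rule covering_number_upper[OF j UNIV_point _ power3_less[OF R]]) simp
    also have "\<dots> = 128 ^ 3 * 16384 ^ Suc k"
      unfolding cube_ratio[OF R(1)] q by (simp only: powr_256_sq powr_65536)
    finally show ?thesis using C(1) by (simp add: field_simps)
  qed
  then have "65536 powr s \<le> 16384" by (rule le_if_power_le_const_mult) simp
  then have "65536 powr s \<le> 65536 powr (7 / 8)" by simp
  then show ?thesis by (simp only: powr_le_cancel_iff)
qed

lemma lower_spectrum_1_greater: "3 / 4 < lower_spectrum (sponge_of 1) (1 / 3)"
proof -
  have "3 / 4 = log 65536 4096" using log_powr_cancel[of 65536 "3 / 4"] by simp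
  also have "\<dots> < log 65536 6144" by simp
  also have "\<dots> \<le> Sup (insert 0 (lower_exponents (sponge_of 1)))"
  proof (rule cSup_upper)
    have "log 65536 6144 \<in> lower_exponents (sponge_of 1)"
      unfolding lower_exponents_def using covering_number_1_ge
      by (auto intro!: exI[of _ "1 / (6144 * 64 ^ 3 * (3 / 2) ^ 5)"])
    then show "log 65536 6144 \<in> insert 0 (lower_exponents (sponge_of 1))" by blast
    show "bdd_above (insert 0 (lower_exponents (sponge_of 1)))"
      by (rule bdd_aboveI[of _ "7 / 8"]) (use lower_exponents_le[of 1] in auto)
  qed
  finally show ?thesis unfolding lower_spectrum_third .
qed

section \<open>Topology, fibres and bi-Lipschitz maps\<close>

definition swap :: "(3 \<Rightarrow> nat set) \<Rightarrow> 3 \<Rightarrow> nat set" where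
  "swap A = A(0 := A 1, 1 := A 0)"

lemma swap_swap [simp]: "swap (swap A) = A"
  by (simp add: swap_def fun_eq_iff)

lemma swap_addresses: "A \<in> addresses 0 \<longleftrightarrow> swap A \<in> addresses 1"
  by (simp add: addresses_def swap_def)

text \<open>Level \<open>2 * a\<close> fixes \<open>4 * a\<close> letters of coordinate 1, as many
  as level \<open>a\<close> fixes of coordinate 0. Halving the level gives a Hoelder estimate of
  exponent \<open>1 / 2\<close>, enough for continuity.\<close>

lemma trunc_swap:
  assumes "trunc (2 * a) A = trunc (2 * a) B"
  shows "trunc a (swap A) = trunc a (swap B)"
proof -
  have t: "A q \<inter> {..<depth q * (2 * a)} = B q \<inter> {..<depth q * (2 * a)}" for q
    using assms by (simp add: trunc_def fun_eq_iff)
  have "k \<in> A q \<longleftrightarrow> k \<in> B q" if "k < depth q * (2 * a)" for k q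
    using t[of q] that by (metis IntD1 IntI lessThan_iff)
  then show ?thesis
    by (intro ext set_eqI) (auto simp: trunc_def swap_def depth_def split: if_splits)
qed

definition swap_point :: "real ^ 3 \<Rightarrow> real ^ 3" where
  "swap_point x = point (swap (inv point x))"

lemma swap_point_point [simp]: "swap_point (point A) = point (swap A)"
  by (simp add: swap_point_def inv_f_f[OF inj_point])

lemma continuous_on_swap_point: "continuous_on (point ` X) swap_point"
  unfolding continuous_on_iff
proof (intro ballI allI impI)
  fix x e :: real and y assume "y \<in> point ` X" "0 < e"
  then obtain A where A: "y = point A" by blast
  obtain a where a: "(1 / 256 :: real) ^ a < e / 3"
    using real_arch_pow_inv[of "e / 3" "1 / 256"] \<open>0 < e\<close> by auto
  show "\<exists>d>0. \<forall>x'\<in>point ` X. dist x' y < d \<longrightarrow> dist (swap_point x') (swap_point y) < e"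
  proof (intro exI[of _ "(1 / 256) ^ (2 * a)"] conjI ballI impI)
    fix z assume "z \<in> point ` X" "dist z y < (1 / 256) ^ (2 * a)"
    then obtain B where B: "z = point B" "dist (point B) (point A) < (1 / 256) ^ (2 * a)" using A by blast
    have "trunc a (swap B) = trunc a (swap A)" by (rule trunc_swap[OF trunc_eqI[OF B(2)]])
    from dist_point_le[OF this] show "dist (swap_point z) (swap_point y) < e"
      using a by (simp add: A B(1))
  qed simp
qed

lemma sponges_homeomorphic: "sponge_of 0 homeomorphic sponge_of 1"
proof -
  have im: "swap ` addresses 0 = addresses 1"
  proof
    show "swap ` addresses 0 \<subseteq> addresses 1" using swap_addresses by blast
    show "addresses 1 \<subseteq> swap ` addresses 0" using swap_addresses by (metis image_eqI subsetI swap_swap)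
  qed
  then have im': "swap ` addresses 1 = addresses 0" by (auto simp: image_image im[symmetric])
  have "homeomorphism (sponge_of 0) (sponge_of 1) swap_point swap_point"
    unfolding sponge_digits
    by (rule homeomorphismI) (use continuous_on_swap_point im im' in \<open>auto simp: image_image\<close>)
  then show ?thesis unfolding homeomorphic_def by blast
qed

text \<open>In the last coordinate the fibre over the zero digits has one element, while the fibre
  over the digits 2 has two.\<close>

lemma not_uniform_fibres:
  assumes j: "j \<noteq> 2"
  shows "\<not> uniform_fibres grid (digits j)"
proof
  assume uf: "uniform_fibres grid (digits j)"
  have le: "q \<le> 2" for q :: 3 using order_3 by (cases q rule: cases_3) auto
  \<comment> \<open>\<open>restrict\<close> leaves \<open>undefined\<close> only at the last
    coordinate 2, which the update overwrites.\<close>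
  have upd: "(restrict i {..<2})(2 := k) = i(2 := k)" for i :: "3 \<Rightarrow> nat" and k
    using le by (auto simp: fun_eq_iff restrict_def less_le)
  have proj: "proj {..2} (digits j) = digits j"
  proof -
    have "{..2} = (UNIV :: 3 set)" using le by auto
    then show ?thesis by (simp add: proj_def restrict_UNIV)
  qed
  have count: "fibre_count grid (digits j) 2 (restrict i {..<2}) = card {k. k < 256 \<and> i(2 := k) \<in> digits j}" for i
    unfolding fibre_count_def upd proj by (simp add: grid_def)
  have "{k. k < 256 \<and> (\<lambda>_. 0)(2 := k) \<in> digits j} = {0}" using j by (auto simp: digits_def)
  moreover have "{k. k < 256 \<and> (\<lambda>_. 2)(2 := k) \<in> digits j} = {0, 2}" using j by (auto simp: digits_def)
  ultimately have "fibre_count grid (digits j) 2 (restrict (\<lambda>_. 0) {..<2}) \<noteq>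
      fibre_count grid (digits j) 2 (restrict (\<lambda>_. 2) {..<2})" by (simp add: count)
  moreover have "(\<lambda>_. 0) \<in> digits j" "(\<lambda>_. 2) \<in> digits j" by (auto simp: digits_def)
  moreover have "\<exists>p. p < (2::3)" using order_3 by blast
  ultimately show False using uf unfolding uniform_fibres_def proj_def by blast
qed

lemma card_digits: "2 \<le> card (digits j)"
proof -
  have "digits j \<subseteq> (\<Pi>\<^sub>E q\<in>UNIV. {..<grid q})" using digits_subset by (auto simp: digit_box_def)
  then have "finite (digits j)" by (rule finite_subset) (intro finite_PiE, auto)
  moreover have "{\<lambda>_. 0, \<lambda>_. 2} \<subseteq> digits j" by (auto simp: digits_def)
  ultimately have "card {\<lambda>_::3. 0::nat, \<lambda>_. 2} \<le> card (digits j)" by (rule card_mono)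
  moreover have "(\<lambda>_::3. 0::nat) \<noteq> (\<lambda>_. 2)" by (simp add: fun_eq_iff)
  ultimately show ?thesis by simp
qed

text \<open>A direct count replaces the invariance of the spectra: around the all-2 point the first
  sponge has growth rate at least 16384 between levels \<open>a\<close> and \<open>3 * a\<close>,
  while the second allows at most 12288.\<close>

lemma sponges_not_bi_lipschitz: "\<not> bi_lipschitz_equivalent (sponge_of 0) (sponge_of 1)"
proof
  assume "bi_lipschitz_equivalent (sponge_of 0) (sponge_of 1)"
  then obtain f c0 where f: "bij_betw f (sponge_of 0) (sponge_of 1)" "c0-lipschitz_on (sponge_of 0) f"
      "c0-lipschitz_on (sponge_of 1) (inv_into (sponge_of 0) f)"
    unfolding bi_lipschitz_equivalent_def by blast
  \<comment> \<open>Enlarging the Lipschitz constant to a power of 256 turns it into a shift by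
    \<open>t\<close> levels.\<close>
  obtain t where "c0 < (256::real) ^ t" using real_arch_pow[of 256 c0] by auto
  then have lip: "(256 ^ t)-lipschitz_on (sponge_of 0) f"
      "(256 ^ t)-lipschitz_on (sponge_of 1) (inv_into (sponge_of 0) f)"
    using f(2,3) by (auto intro: lipschitz_on_le)
  let ?x = "point (\<lambda>_. UNIV)"
  have "f ?x \<in> sponge_of 1" using f(1) UNIV_point by (auto simp: bij_betw_def)
  then obtain A where A: "f ?x = point A" "A \<in> addresses 1" by (rule sponge_cases)
  have "(16384::real) ^ k \<le> 64 ^ (4 * t + 5) * (3 / 2) ^ (4 * t + 5) * 12288 ^ k" for k :: nat
  proof -
    \<comment> \<open>With this \<open>a\<close> the image ball of radius
      \<open>256 ^ t * ?R\<close> lies in a cylinder of level \<open>k\<close>. The denominator of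
      \<open>?r\<close> cancels the factor \<open>2 * c\<close> of
      \<open>covering_number_bi_lipschitz\<close>.\<close>
    define a where "a = k + t + 1"
    let ?r = "(1 / 256) ^ (3 * a + 1) / (2 * 256 ^ t) :: real"
    let ?R = "3 * (1 / 256) ^ a :: real"
    have "(16384 :: real) ^ k = 128 ^ (2 * k)" by (simp add: power_mult)
    also have "\<dots> \<le> 128 ^ (3 * a - a)" by (rule power_increasing) (auto simp: a_def)
    also have "\<dots> = real (descendants 0 a (3 * a) (\<lambda>_. UNIV))"
      by (rule descendants_UNIV[symmetric]) (auto simp: depth_def)
    also have "\<dots> \<le> real (covering_number (cball ?x ?R \<inter> sponge_of 0) (2 * 256 ^ t * ?r))"
      unfolding of_nat_le_iff by (rule covering_number_ball_ge) auto
    also have "\<dots> \<le> real (covering_number (cball (f ?x) (256 ^ t * ?R) \<inter> sponge_of 1) ?r)"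
      unfolding of_nat_le_iff by (rule covering_number_bi_lipschitz[OF f(1) lip UNIV_point]) simp
    also have "\<dots> \<le> real (descendants 1 k (3 * k + 4 * t + 5) A)"
      unfolding of_nat_le_iff A(1)
    proof (rule covering_number_ball_le)
      show "k = 0 \<or> 256 ^ t * ?R < (1 / 256) ^ k"
        by (simp add: a_def power_add power_one_over field_simps)
      show "3 * (1 / 256) ^ (3 * k + 4 * t + 5) \<le> ?r"
        by (simp add: a_def power_add power_one_over power_mult field_simps)
          (simp add: power3_eq_cube power4_eq_xxxx)
    qed
    also have "\<dots> \<le> 64 ^ (3 * k + 4 * t + 5 - k) * 2 ^ k * (3 / 2) ^ (3 * k + 4 * t + 5 - 2 * k)"
      by (rule descendants_1_le) (use A in auto)
    also have "3 * k + 4 * t + 5 - k = 2 * k + (4 * t + 5)" by simp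
    also have "3 * k + 4 * t + 5 - 2 * k = k + (4 * t + 5)" by simp
    also have "(64::real) ^ (2 * k + (4 * t + 5)) * 2 ^ k * (3 / 2) ^ (k + (4 * t + 5)) =
        64 ^ (4 * t + 5) * (3 / 2) ^ (4 * t + 5) * 12288 ^ k"
      by (rule power_product_eq)
    finally show ?thesis .
  qed
  then have "(16384::real) \<le> 12288" by (rule le_if_power_le_const_mult) simp
  then show False by simp
qed

theorem proposition3p5:
  shows "\<exists>(n :: 3 \<Rightarrow> nat) D D'.
    2 \<le> n 0 \<and> n 0 < n 1 \<and> n 1 < n 2 \<and>
    D \<subseteq> digit_box n \<and> 2 \<le> card D \<and>
    D' \<subseteq> digit_box n \<and> 2 \<le> card D' \<and>
    (let F = sponge n D; F' = sponge n D' in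
      \<not> uniform_fibres n D \<and> \<not> uniform_fibres n D' \<and>
      F homeomorphic F' \<and>
      has_box_dimension F (box_dimension F) \<and>
      has_box_dimension F' (box_dimension F') \<and>
      box_dimension F = box_dimension F' \<and>
      lower_dimension F = lower_dimension F' \<and>
      assouad_dimension F = assouad_dimension F' \<and>
      (\<exists>\<theta>\<in>{0<..<1}. assouad_spectrum F \<theta> \<noteq> assouad_spectrum F' \<theta>) \<and>
      (\<exists>\<theta>\<in>{0<..<1}. lower_spectrum F \<theta> \<noteq> lower_spectrum F' \<theta>) \<and>
      \<not> bi_lipschitz_equivalent F F')"
proof (rule exI[of _ grid], rule exI[of _ "digits 0"], rule exI[of _ "digits 1"], unfold Let_def, intro conjI)
  show "2 \<le> grid 0" "grid 0 < grid 1" "grid 1 < grid 2" by (simp_all add: grid_def)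
  have box: "box_dimension (sponge_of j) = ln 96 / ln 256" if "j \<noteq> 2" for j
    by (rule box_dimension_eqI[OF has_box_dimension_sponge[OF that]])
  show "has_box_dimension (sponge_of 0) (box_dimension (sponge_of 0))"
    "has_box_dimension (sponge_of 1) (box_dimension (sponge_of 1))"
    by (simp_all add: box has_box_dimension_sponge)
  show "box_dimension (sponge_of 0) = box_dimension (sponge_of 1)" by (simp add: box)
  show "lower_dimension (sponge_of 0) = lower_dimension (sponge_of 1)"
    by (simp add: lower_dimension_sponge)
  show "assouad_dimension (sponge_of 0) = assouad_dimension (sponge_of 1)"
    by (simp add: assouad_dimension_sponge)
  show "\<exists>\<theta>\<in>{0<..<1}. assouad_spectrum (sponge_of 0) \<theta> \<noteq> assouad_spectrum (sponge_of 1) \<theta>"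
    using assouad_spectrum_0_ge assouad_spectrum_1_less by (intro bexI[of _ "1 / 3"]) auto
  show "\<exists>\<theta>\<in>{0<..<1}. lower_spectrum (sponge_of 0) \<theta> \<noteq> lower_spectrum (sponge_of 1) \<theta>"
    using lower_spectrum_0_le lower_spectrum_1_greater by (intro bexI[of _ "1 / 3"]) auto
qed (simp_all add: digits_subset card_digits not_uniform_fibres sponges_homeomorphic sponges_not_bi_lipschitz)

end
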